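(* Suppose there exist $P_i\succ0$ ($n\times n$, $i\in\mathcal I$) and $\Pi=[\pi_{i,j}]_{i,j\in\mathcal I}\in\mathcal M$ satisfying $$A_i^\top P_i+P_iA_i+\sum_{j\in\mathcal I}\pi_{j,i}P_j+C_i^\top C_i\prec0\qquad\forall i\in\mathcal I .$$ Then the switched feedback law $\sigma(x)=\min\{\operatorname{argmin}_{i\in\mathcal I}x^\top P_ix\}$ makes $x^*=0$ globally asymptotically stable for the switched system $\dot x=A_\sigma x+E_\sigma\psi$, $z=C_\sigma x+F_\sigma\psi$ with $E_i=E$ for all $i\in\mathcal I$, and ensures that (with $F_i=0$ for all $i\in\mathcal I$, as required for $J_2$ to be defined) $$J_2<\min_{i\in\mathcal I}\operatorname{tr}(E^\top P_iE).$$
   Context: $\mathcal I=\{1,\dots,N\}$; $A_i\in\mathbb R^{n\times n}$, $C_i\in\mathbb R^{p\times n}$, $E_i\in\mathbb R^{n\times q}$, $F_i\in\mathbb R^{p\times q}$ for $i\in\mathcal I$; $E\in\mathbb R^{n\times q}$; $\psi(t)\in\mathbb R^q$ is an exogenous disturbance. $\mathcal M:=\{\Pi\in\mathbb R^{N\times N}\mid \pi_{i,j}\ge0\ \forall i\ne j,\ \sum_{i=1}^N\pi_{i,j}=0\ \forall j\}$. Solution concept (Filippov-type, allowing sliding motions). Put $\xi_i(x,t):=A_ix+E_i\psi(t)$, $\mathcal X_i:=\{x\in\mathbb R^n\mid\sigma(x)=i\}$, $\mathrm I(x):=\{i\in\mathcal I\mid$ every neighborhood of $x$ meets $\mathcal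 X_i\}$, $\dot v_i(x,\xi):=x^\top P_i\xi+\xi^\top P_ix$. A solution of the closed loop is an absolutely continuous $x:\mathbb R_{\ge0}\to\mathbb R^n$ such that, for almost all $t$, with $x=x(t)$, $$\dot x(t)=\sum_{i\in\mathrm I(x)}\alpha_i(x)\xi_i(x,t)\quad\text{and}\quad\dot v_{\sigma(x)}\Big(x,\sum_{i\in\mathrm I(x)}\alpha_i(x)\xi_i(x,t)\Big)\le\sum_{i\in\mathrm I(x)}\dot v_i(x,\alpha_i(x)\xi_i(x,t))$$ for some weights $\alpha_i(x)\ge0$ ($i\in\mathrm I(x)$) with $\sum_{i\in\mathrm I(x)}\alpha_i(x)=1$; the weights are taken, without loss of generality, such that $t\mapsto\alpha_i(x(t))$ is almost everywhere continuous. Existence of solutions in this sense is assumed wherever needed. Global asymptotic stability of the origin refers to $\psi\equiv0$ and to such solutions. $\mathcal H_2$ index (for $F_i=0$, $E_i=E$ for all $i$). The modified output is $z_\alpha:=\sum_{i\in\mathrm I(x)}\alpha_i(x)z_i$ with $z_i:=C_ix+F_i\psi$. For $k=1,\dots,q$ let $z_\alpha^k$ be the modified output along a solution generated, from rest, by the impulsive disturbance $\psi(t)=e_k\delta(t)$, i.e. a solution with zero disturbance and $x(0)=Ee_k$, where $e_k$ is the $k$-th standard basis vector of $\mathbb R^q$. Then $J_2:=\sum_{k=1}^q\|z_\alpha^k\|_2^2$, with $\|s\|_2^2=\int_0^\infty s(t)^\top s(t)\,dt$.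
   Formalization: The strict bound on J_2 is stated only for E ≠ 0, since for E = 0 both J_2 and min tr(E^T P_i E) equal 0 and the strict inequality fails; global asymptotic stability is stated for every E. *)

theory Defs
  imports "HOL-Analysis.Analysis"
begin

definition pos_definite :: "real^'n^'n \<Rightarrow> bool" where
  "pos_definite M \<longleftrightarrow> transpose M = M \<and> (\<forall>x. x \<noteq> 0 \<longrightarrow> x \<bullet> (M *v x) > 0)"

definition neg_definite :: "real^'n^'n \<Rightarrow> bool" where
  "neg_definite M \<longleftrightarrow> transpose M = M \<and> (\<forall>x. x \<noteq> 0 \<longrightarrow> x \<bullet> (M *v x) < 0)"

text \<open>Only the entries with indices in \<open>{1..N}\<close> are relevant.\<close>

definition metzler_zero_colsum :: "nat \<Rightarrow> (nat \<Rightarrow> nat \<Rightarrow> real) set" where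
  "metzler_zero_colsum N =
     {\<pi>. (\<forall>i\<in>{1..N}. \<forall>j\<in>{1..N}. i \<noteq> j \<longrightarrow> \<pi> i j \<ge> 0) \<and>
          (\<forall>j\<in>{1..N}. (\<Sum>i=1..N. \<pi> i j) = 0)}"

definition min_switching :: "nat \<Rightarrow> (nat \<Rightarrow> real^'n^'n) \<Rightarrow> real^'n \<Rightarrow> nat" where
  "min_switching N P x = Min {i. is_arg_min (\<lambda>i. x \<bullet> (P i *v x)) (\<lambda>i. i \<in> {1..N}) i}"

text \<open>Absolute continuity on the unbounded time axis is meant locally, that is,
  on every compact interval \<open>{0..T}\<close>.\<close>

definition abs_continuous_on_interval ::
    "real \<Rightarrow> real \<Rightarrow> (real \<Rightarrow> 'a::real_normed_vector) \<Rightarrow> bool" where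
  "abs_continuous_on_interval S T f \<longleftrightarrow>
     (\<forall>\<epsilon>>0. \<exists>\<delta>>0. \<forall>(m::nat) a b.
        (\<forall>i<m. S \<le> a i \<and> a i \<le> b i \<and> b i \<le> T) \<longrightarrow>
        disjoint_family_on (\<lambda>i. {a i<..<b i}) {..<m} \<longrightarrow>
        (\<Sum>i<m. b i - a i) < \<delta> \<longrightarrow>
        (\<Sum>i<m. norm (f (b i) - f (a i))) < \<epsilon>)"

definition abs_continuous_halfline :: "(real \<Rightarrow> 'a::real_normed_vector) \<Rightarrow> bool" where
  "abs_continuous_halfline f \<longleftrightarrow> (\<forall>T\<ge>0. abs_continuous_on_interval 0 T f)"

definition mode_field ::
    "(nat \<Rightarrow> real^'n^'n) \<Rightarrow> (nat \<Rightarrow> real^'q^'n) \<Rightarrow> (real \<Rightarrow> real^'q) \<Rightarrow> nat \<Rightarrow> real^'n \<Rightarrow> real \<Rightarrow> real^'n" where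
  "mode_field A E \<psi> i x t = A i *v x + E i *v \<psi> t"

definition mode_region :: "(real^'n \<Rightarrow> nat) \<Rightarrow> nat \<Rightarrow> (real^'n) set" where
  "mode_region \<sigma> i = {x. \<sigma> x = i}"

definition active_modes :: "nat \<Rightarrow> (real^'n \<Rightarrow> nat) \<Rightarrow> real^'n \<Rightarrow> nat set" where
  "active_modes N \<sigma> x =
     {i\<in>{1..N}. \<forall>U. open U \<and> x \<in> U \<longrightarrow> U \<inter> mode_region \<sigma> i \<noteq> {}}"

definition vdot :: "(nat \<Rightarrow> real^'n^'n) \<Rightarrow> nat \<Rightarrow> real^'n \<Rightarrow> real^'n \<Rightarrow> real" where
  "vdot P i x \<xi> = x \<bullet> (P i *v \<xi>) + \<xi> \<bullet> (P i *v x)"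

definition closed_loop_solution ::
    "nat \<Rightarrow> (nat \<Rightarrow> real^'n^'n) \<Rightarrow> (nat \<Rightarrow> real^'q^'n) \<Rightarrow> (nat \<Rightarrow> real^'n^'n) \<Rightarrow> (real^'n \<Rightarrow> nat) \<Rightarrow>
     (real \<Rightarrow> real^'q) \<Rightarrow> (real \<Rightarrow> real^'n) \<Rightarrow> (nat \<Rightarrow> real^'n \<Rightarrow> real) \<Rightarrow> bool" where
  "closed_loop_solution N A E P \<sigma> \<psi> x \<alpha> \<longleftrightarrow>
     abs_continuous_halfline x \<and>
     (AE t in lebesgue_on {0..}.
        (\<forall>i\<in>active_modes N \<sigma> (x t). \<alpha> i (x t) \<ge> 0) \<and>
        (\<Sum>i\<in>active_modes N \<sigma> (x t). \<alpha> i (x t)) = 1 \<and>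
        (x has_vector_derivative
           (\<Sum>i\<in>active_modes N \<sigma> (x t). \<alpha> i (x t) *\<^sub>R mode_field A E \<psi> i (x t) t)) (at t within {0..}) \<and>
        vdot P (\<sigma> (x t)) (x t)
           (\<Sum>i\<in>active_modes N \<sigma> (x t). \<alpha> i (x t) *\<^sub>R mode_field A E \<psi> i (x t) t)
         \<le> (\<Sum>i\<in>active_modes N \<sigma> (x t).
              vdot P i (x t) (\<alpha> i (x t) *\<^sub>R mode_field A E \<psi> i (x t) t))) \<and>
     (\<forall>i\<in>{1..N}. AE t in lebesgue_on {0..}. continuous (at t within {0..}) (\<lambda>s. \<alpha> i (x s)))"

definition origin_globally_asymptotically_stable ::
    "nat \<Rightarrow> (nat \<Rightarrow> real^'n^'n) \<Rightarrow> (nat \<Rightarrow> real^'q^'n) \<Rightarrow> (nat \<Rightarrow> real^'n^'n) \<Rightarrow> (real^'n \<Rightarrow> nat) \<Rightarrow> bool" where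
  "origin_globally_asymptotically_stable N A E P \<sigma> \<longleftrightarrow>
     (\<forall>\<epsilon>>0. \<exists>\<delta>>0. \<forall>x \<alpha>. closed_loop_solution N A E P \<sigma> (\<lambda>t. 0) x \<alpha> \<longrightarrow> norm (x 0) < \<delta> \<longrightarrow>
        (\<forall>t\<ge>0. norm (x t) < \<epsilon>)) \<and>
     (\<forall>x \<alpha>. closed_loop_solution N A E P \<sigma> (\<lambda>t. 0) x \<alpha> \<longrightarrow> (x \<longlongrightarrow> 0) at_top)"

definition modified_output ::
    "nat \<Rightarrow> (nat \<Rightarrow> real^'n^'p) \<Rightarrow> (nat \<Rightarrow> real^'q^'p) \<Rightarrow> (real^'n \<Rightarrow> nat) \<Rightarrow>
     (real \<Rightarrow> real^'q) \<Rightarrow> (real \<Rightarrow> real^'n) \<Rightarrow> (nat \<Rightarrow> real^'n \<Rightarrow> real) \<Rightarrow> real \<Rightarrow> real^'p" where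
  "modified_output N C F \<sigma> \<psi> x \<alpha> t =
     (\<Sum>i\<in>active_modes N \<sigma> (x t). \<alpha> i (x t) *\<^sub>R (C i *v x t + F i *v \<psi> t))"

text \<open>Extended-real valued, so that a strict upper bound on it includes finiteness.\<close>

definition sq_L2_norm :: "(real \<Rightarrow> real^'p) \<Rightarrow> ennreal" where
  "sq_L2_norm s = (\<integral>\<^sup>+t. ennreal (s t \<bullet> s t) \<partial>lebesgue_on {0..})"

text \<open>A response to the impulse \<open>e\<^sub>k \<delta>(t)\<close> from rest is an undisturbed solution started at \<open>E e\<^sub>k\<close>.
  Solutions need not be unique, so the index depends on the chosen responses \<open>x k\<close>, \<open>\<alpha> k\<close>.\<close>

definition impulse_responses ::
    "nat \<Rightarrow> (nat \<Rightarrow> real^'n^'n) \<Rightarrow> real^'q^'n \<Rightarrow> (nat \<Rightarrow> real^'n^'n) \<Rightarrow> (real^'n \<Rightarrow> nat) \<Rightarrow>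
     ('q \<Rightarrow> real \<Rightarrow> real^'n) \<Rightarrow> ('q \<Rightarrow> nat \<Rightarrow> real^'n \<Rightarrow> real) \<Rightarrow> bool" where
  "impulse_responses N A E P \<sigma> x \<alpha> \<longleftrightarrow>
     (\<forall>k. closed_loop_solution N A (\<lambda>i. E) P \<sigma> (\<lambda>t. 0) (x k) (\<alpha> k) \<and> x k 0 = E *v axis k 1)"

definition J2 ::
    "nat \<Rightarrow> (nat \<Rightarrow> real^'n^'p) \<Rightarrow> (nat \<Rightarrow> real^'q^'p) \<Rightarrow> (real^'n \<Rightarrow> nat) \<Rightarrow>
     ('q \<Rightarrow> real \<Rightarrow> real^'n) \<Rightarrow> ('q \<Rightarrow> nat \<Rightarrow> real^'n \<Rightarrow> real) \<Rightarrow> ennreal" where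
  "J2 N C F \<sigma> x \<alpha> = (\<Sum>k\<in>UNIV. sq_L2_norm (modified_output N C F \<sigma> (\<lambda>t. 0) (x k) (\<alpha> k)))"

end

theory Submission
  imports Defs
begin

text \<open>
  The common Lyapunov function is \<open>v x = Min\<^sub>i (x \<bullet> P i x)\<close>. At almost every time \<open>t\<close> it is touched from
  above along a solution by the smooth function \<open>s \<mapsto> x s \<bullet> P (\<sigma> (x t)) (x s)\<close>. The selection
  inequality in the solution concept bounds the derivative of the latter by a convex combination over
  the active modes, all of which attain the minimum; there the coupling term has a sign, so the matrix
  inequalities and convexity of the squared norm give the bound \<open>- c |x|\<^sup>2 - |z|\<^sup>2\<close>. A one-sided
  derivative bound off a null set integrates because \<open>v (x t)\<close> is locally absolutely continuous. The
  resulting estimate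
  \<open>v (x T) + c \<integral> |x|\<^sup>2 + \<integral> |z|\<^sup>2 \<le> v (x 0)\<close> yields decay of \<open>v\<close> and, summed over the impulse
  responses, the bound on \<open>J2\<close>; strictness comes from \<open>c \<integral> |x|\<^sup>2 > 0\<close> for a nonzero initial state.
  To avoid measurability questions, \<open>|z|\<^sup>2\<close> is replaced there by step functions supported on
  finitely many disjoint compact sets: these are upper semicontinuous, which is the direction that a
  bound on right derivatives needs.
\<close>

section \<open>Absolute continuity and one-sided derivatives\<close>

lemma abs_continuous_on_intervalE:
  fixes f :: "real \<Rightarrow> 'a::real_normed_vector"
  assumes "abs_continuous_on_interval a b f" "e > 0"
  obtains \<delta> where "\<delta> > 0" "\<forall>(m::nat) l r. (\<forall>i<m. a \<le> l i \<and> l i \<le> r i \<and> r i \<le> b) \<longrightarrow>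
      disjoint_family_on (\<lambda>i. {l i<..<r i}) {..<m} \<longrightarrow> (\<Sum>i<m. r i - l i) < \<delta> \<longrightarrow>
      (\<Sum>i<m. norm (f (r i) - f (l i))) < e"
  using assms(1)[unfolded abs_continuous_on_interval_def, THEN spec, THEN mp, OF assms(2)]
  by (elim exE conjE)

text \<open>Families consisting of a single interval already give the usual epsilon-delta
  condition.\<close>

lemma abs_continuous_on_interval_imp_continuous_on:
  fixes f :: "real \<Rightarrow> 'a::real_normed_vector"
  assumes "abs_continuous_on_interval a b f"
  shows "continuous_on {a..b} f"
  unfolding continuous_on_iff
proof (intro ballI allI impI)
  fix t e :: real assume t: "t \<in> {a..b}" and "e > 0"
  obtain \<delta> where "\<delta> > 0" and \<delta>: "\<forall>(m::nat) l r. (\<forall>i<m. a \<le> l i \<and> l i \<le> r i \<and> r i \<le> b) \<longrightarrow>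
      disjoint_family_on (\<lambda>i. {l i<..<r i}) {..<m} \<longrightarrow> (\<Sum>i<m. r i - l i) < \<delta> \<longrightarrow> (\<Sum>i<m. norm (f (r i) - f (l i))) < e"
    by (rule abs_continuous_on_intervalE[OF assms \<open>e > 0\<close>]) (rule that)
  have *: "norm (f r - f l) < e" if "a \<le> l" "l \<le> r" "r \<le> b" "r - l < \<delta>" for l r
    using \<delta>[THEN spec[of _ 1], THEN spec[of _ "\<lambda>_. l"], THEN spec[of _ "\<lambda>_. r"]] that by (simp add: disjoint_family_on_def)
  have "dist (f s) (f t) < e" if "s \<in> {a..b}" "dist s t < \<delta>" for s
    using *[of s t] *[of t s] that t
    by (cases "s \<le> t") (auto simp: dist_norm norm_minus_commute)
  then show "\<exists>d>0. \<forall>s\<in>{a..b}. dist s t < d \<longrightarrow> dist (f s) (f t) < e"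
    using \<open>\<delta> > 0\<close> by blast
qed

lemma abs_continuous_on_interval_subset:
  assumes "abs_continuous_on_interval a b f" "a \<le> a'" "b' \<le> b"
  shows "abs_continuous_on_interval a' b' f"
  unfolding abs_continuous_on_interval_def
proof (intro allI impI)
  fix e :: real assume "e > 0"
  obtain \<delta> where "\<delta> > 0" and \<delta>: "\<forall>(m::nat) l r. (\<forall>i<m. a \<le> l i \<and> l i \<le> r i \<and> r i \<le> b) \<longrightarrow>
      disjoint_family_on (\<lambda>i. {l i<..<r i}) {..<m} \<longrightarrow> (\<Sum>i<m. r i - l i) < \<delta> \<longrightarrow>
      (\<Sum>i<m. norm (f (r i) - f (l i))) < e"
    by (rule abs_continuous_on_intervalE[OF assms(1) \<open>e > 0\<close>]) (rule that)
  have "\<forall>i<m. a \<le> l i \<and> l i \<le> r i \<and> r i \<le> b"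
    if "\<forall>i<m. a' \<le> l i \<and> l i \<le> r i \<and> r i \<le> b'" for m :: nat and l r
    using that assms(2,3) by force
  with \<open>\<delta> > 0\<close> \<delta> show "\<exists>\<delta>>0. \<forall>(m::nat) l r. (\<forall>i<m. a' \<le> l i \<and> l i \<le> r i \<and> r i \<le> b') \<longrightarrow>
      disjoint_family_on (\<lambda>i. {l i<..<r i}) {..<m} \<longrightarrow> (\<Sum>i<m. r i - l i) < \<delta> \<longrightarrow>
      (\<Sum>i<m. norm (f (r i) - f (l i))) < e"
    by (intro exI[of _ \<delta>]) simp
qed

text \<open>Short families have small total variation of \<open>g\<close> and small total length, so
  both terms of the bound are small. This serves for \<open>v (x t)\<close> plus integral terms:
  \<open>K\<close> accounts for increments of the solution, \<open>L\<close> for elapsed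
  time.\<close>

lemma abs_continuous_on_interval_dominated:
  fixes f :: "real \<Rightarrow> 'a::real_normed_vector" and g :: "real \<Rightarrow> 'b::real_normed_vector"
  assumes g: "abs_continuous_on_interval a b g" and "0 \<le> K" "0 \<le> L"
    and dom: "\<And>s t. \<lbrakk>a \<le> s; s \<le> t; t \<le> b\<rbrakk> \<Longrightarrow> norm (f t - f s) \<le> K * norm (g t - g s) + L * (t - s)"
  shows "abs_continuous_on_interval a b f"
  unfolding abs_continuous_on_interval_def
proof (intro allI impI)
  fix e :: real assume "e > 0"
  \<comment> \<open>Half of \<open>e\<close> is reserved for each summand; \<open>K + 1\<close> and
    \<open>L + 1\<close> avoid division by zero and make the final estimate strict.\<close>
  define e' where "e' = e / 2 / (K + 1)"
  have "e' > 0" using \<open>e > 0\<close> \<open>0 \<le> K\<close> by (simp add: e'_def)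
  obtain \<delta> where "\<delta> > 0" and \<delta>: "\<forall>(m::nat) l r. (\<forall>i<m. a \<le> l i \<and> l i \<le> r i \<and> r i \<le> b) \<longrightarrow>
      disjoint_family_on (\<lambda>i. {l i<..<r i}) {..<m} \<longrightarrow> (\<Sum>i<m. r i - l i) < \<delta> \<longrightarrow> (\<Sum>i<m. norm (g (r i) - g (l i))) < e'"
    by (rule abs_continuous_on_intervalE[OF g \<open>e' > 0\<close>]) (rule that)
  define d where "d = min \<delta> (e / 2 / (L + 1))"
  have "d > 0" using \<open>\<delta> > 0\<close> \<open>e > 0\<close> \<open>0 \<le> L\<close> by (simp add: d_def)
  have "(\<Sum>i<m. norm (f (r i) - f (l i))) < e"
    if lr: "\<forall>i<m. a \<le> l i \<and> l i \<le> r i \<and> r i \<le> b"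
      and disj: "disjoint_family_on (\<lambda>i. {l i<..<r i}) {..<m}"
      and len: "(\<Sum>i<m. r i - l i) < d" for m :: nat and l r
  proof -
    have sumg: "(\<Sum>i<m. norm (g (r i) - g (l i))) < e'"
      using \<delta> lr disj len by (simp add: d_def)
    have "(\<Sum>i<m. norm (f (r i) - f (l i))) \<le> (\<Sum>i<m. K * norm (g (r i) - g (l i)) + L * (r i - l i))"
      using dom lr by (intro sum_mono) auto
    also have "\<dots> = K * (\<Sum>i<m. norm (g (r i) - g (l i))) + L * (\<Sum>i<m. r i - l i)"
      by (simp add: sum.distrib sum_distrib_left)
    also have "\<dots> \<le> K * e' + L * (e / 2 / (L + 1))"
      using sumg len \<open>0 \<le> K\<close> \<open>0 \<le> L\<close> by (intro add_mono mult_left_mono) (auto simp: d_def)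
    also have "\<dots> < (K + 1) * e' + (L + 1) * (e / 2 / (L + 1))"
      using \<open>e' > 0\<close> \<open>e > 0\<close> \<open>0 \<le> L\<close> by (intro add_strict_mono mult_strict_right_mono) auto
    also have "\<dots> = e"
    proof -
      have "(M + 1) * (e / 2 / (M + 1)) = e / 2" if "M \<ge> 0" for M
        using that by (subst times_divide_eq_right) (rule nonzero_mult_div_cancel_left, simp)
      then show ?thesis using \<open>0 \<le> K\<close> \<open>0 \<le> L\<close> by (simp only: e'_def field_sum_of_halves)
    qed
    finally show ?thesis .
  qed
  then show "\<exists>\<delta>>0. \<forall>(m::nat) l r. (\<forall>i<m. a \<le> l i \<and> l i \<le> r i \<and> r i \<le> b) \<longrightarrow>
        disjoint_family_on (\<lambda>i. {l i<..<r i}) {..<m} \<longrightarrow> (\<Sum>i<m. r i - l i) < \<delta> \<longrightarrow>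
        (\<Sum>i<m. norm (f (r i) - f (l i))) < e"
    using \<open>d > 0\<close> by (intro exI[of _ d] conjI allI impI)
qed

text \<open>By additivity the total length is the measure of the union. This turns the small measure
  of an open cover into the length condition of absolute continuity.\<close>

lemma sum_length_disjoint_intervals_le:
  fixes U :: "real set"
  assumes "U \<in> sets lebesgue" "disjoint_family_on (\<lambda>i. {l i<..<r i}) {..<m::nat}"
    and "\<And>i. i < m \<Longrightarrow> l i \<le> r i" "\<And>i. i < m \<Longrightarrow> {l i<..<r i} \<subseteq> U"
  shows "ennreal (\<Sum>i<m. r i - l i) \<le> emeasure lebesgue U"
proof -
  have "ennreal (\<Sum>i<m. r i - l i) = (\<Sum>i<m. emeasure lebesgue {l i<..<r i})"
    using assms(3) by (subst sum_ennreal[symmetric]) auto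
  also have "\<dots> = emeasure lebesgue (\<Union>i<m. {l i<..<r i})"
    using assms(2) by (intro sum_emeasure) auto
  also have "\<dots> \<le> emeasure lebesgue U"
    using assms by (intro emeasure_mono) auto
  finally show ?thesis .
qed

lemma null_set_outer_open:
  fixes N :: "'a::euclidean_space set"
  assumes "N \<in> null_sets lebesgue" "e > 0"
  obtains U where "open U" "N \<subseteq> U" "emeasure lebesgue U < ennreal e"
proof -
  obtain U where U: "open U" "N \<subseteq> U" "emeasure lebesgue (U - N) < ennreal e"
    using sets_lebesgue_outer_open[of N e] assms by blast
  moreover have "emeasure lebesgue (U - N) = emeasure lebesgue U"
    using assms U(1) by (intro emeasure_Diff_null_set) (auto intro: borel_open)
  ultimately show ?thesis using that by auto
qed

text \<open>Cover the exceptional set by an open set \<open>U\<close> of small measure. Absolute continuity makes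
  the variation \<open>\<phi>\<close> of \<open>f\<close> inside \<open>U\<close> small, and \<open>f t \<le> f a + \<eta> (t - a) + \<phi> t\<close> propagates to the
  right: by the derivative bound off \<open>U\<close>, by the growth of \<open>\<phi>\<close> inside \<open>U\<close>.\<close>

lemma abs_continuous_right_derivative_nonpos_imp_le:
  fixes f :: "real \<Rightarrow> real"
  assumes ac: "abs_continuous_on_interval a b f" and "a \<le> b"
    and N: "N \<in> null_sets lebesgue"
    and dini: "\<And>t \<epsilon>. \<lbrakk>a \<le> t; t < b; t \<notin> N; \<epsilon> > 0\<rbrakk> \<Longrightarrow> \<forall>\<^sub>F s in at_right t. f s - f t \<le> \<epsilon> * (s - t)"
  shows "f b \<le> f a"
proof (rule field_le_epsilon)
  fix e :: real assume "0 < e"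
  \<comment> \<open>The error \<open>e\<close> splits into \<open>\<eta> * (b - a)\<close> for a
    slope and \<open>\<eta>\<close> for the variation inside \<open>U\<close>; the added 1 keeps the
    denominator positive when \<open>a = b\<close>.\<close>
  define \<eta> where "\<eta> = e / (b - a + 1)"
  have "\<eta> > 0"
    using \<open>0 < e\<close> \<open>a \<le> b\<close> by (simp add: \<eta>_def)
  have "\<eta> * (b - a + 1) = e"
    using \<open>a \<le> b\<close> by (simp add: \<eta>_def)
  then have \<eta>: "\<eta> * (b - a) + \<eta> = e"
    by (simp add: distrib_left)
  obtain \<delta> where "\<delta> > 0" and \<delta>: "\<forall>(m::nat) l r. (\<forall>i<m. a \<le> l i \<and> l i \<le> r i \<and> r i \<le> b) \<longrightarrow>
      disjoint_family_on (\<lambda>i. {l i<..<r i}) {..<m} \<longrightarrow> (\<Sum>i<m. r i - l i) < \<delta> \<longrightarrow> (\<Sum>i<m. norm (f (r i) - f (l i))) < \<eta>"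
    by (rule abs_continuous_on_intervalE[OF ac \<open>\<eta> > 0\<close>]) (rule that)
  obtain U where U: "open U" "N \<subseteq> U" "emeasure lebesgue U < ennreal \<delta>"
    using null_set_outer_open[OF N \<open>\<delta> > 0\<close>] by blast
  \<comment> \<open>Finite disjoint families of intervals inside \<open>U\<close> that end by time
    \<open>t\<close>; \<open>\<phi> t\<close> below is the variation of \<open>f\<close> over
    them.\<close>
  define fam where "fam t = {(m::nat, l, r).
      (\<forall>i<m. a \<le> l i \<and> l i \<le> r i \<and> r i \<le> t \<and> {l i<..<r i} \<subseteq> U) \<and>
      disjoint_family_on (\<lambda>i. {l i<..<r i}) {..<m}}" for t
  define var where "var = (\<lambda>(m::nat, l, r). \<Sum>i<m. \<bar>f (r i) - f (l i)\<bar>)"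
  define \<phi> where "\<phi> t = Sup (var ` fam t)" for t
  have var_less: "var F \<le> \<eta>" if "F \<in> fam t" "t \<le> b" for F t
  proof -
    obtain m l r where F: "F = (m, l, r)" by (cases F)
    have lr: "\<forall>i<m. a \<le> l i \<and> l i \<le> r i \<and> r i \<le> t \<and> {l i<..<r i} \<subseteq> U"
      and disj: "disjoint_family_on (\<lambda>i. {l i<..<r i}) {..<m}"
      using that by (auto simp: fam_def F)
    have "ennreal (\<Sum>i<m. r i - l i) \<le> emeasure lebesgue U"
      using lr disj U(1) by (intro sum_length_disjoint_intervals_le) (auto intro: borel_open)
    also have "\<dots> < ennreal \<delta>" by (rule U(3))
    finally have "(\<Sum>i<m. r i - l i) < \<delta>"
      by (meson ennreal_leI leD not_le)
    moreover have "\<forall>i<m. a \<le> l i \<and> l i \<le> r i \<and> r i \<le> b"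
      using lr that(2) by fastforce
    ultimately have "(\<Sum>i<m. norm (f (r i) - f (l i))) < \<eta>"
      using \<delta> disj by simp
    then show ?thesis by (simp add: var_def F)
  qed
  have bdd: "bdd_above (var ` fam t)" if "t \<le> b" for t
    using var_less that by (intro bdd_aboveI2) blast
  \<comment> \<open>The empty family, so that the supremum is never taken over the empty
    set.\<close>
  have "(0, \<lambda>_. a, \<lambda>_. a) \<in> fam t" for t
    by (simp add: fam_def disjoint_family_on_def)
  then have ne: "fam t \<noteq> {}" for t
    by blast
  have \<phi>_le: "\<phi> t \<le> \<eta>" if "t \<le> b" for t
    unfolding \<phi>_def using var_less ne that by (intro cSUP_least) auto
  have fam_mono: "fam s \<subseteq> fam t" if "s \<le> t" for s t
    using that unfolding fam_def by (clarsimp split del: if_split) (metis order.trans)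
  have \<phi>_mono: "\<phi> s \<le> \<phi> t" if "s \<le> t" "t \<le> b" for s t
    unfolding \<phi>_def using that
    by (intro cSup_subset_mono bdd image_mono fam_mono) (simp_all add: ne)
  have \<phi>_step: "\<phi> s + \<bar>f t - f s\<bar> \<le> \<phi> t" if st: "a \<le> s" "s \<le> t" "t \<le> b" "{s<..<t} \<subseteq> U" for s t
  proof -
    have "var F \<le> \<phi> t - \<bar>f t - f s\<bar>" if F: "F \<in> fam s" for F
    proof -
      obtain m l r where F_eq: "F = (m, l, r)" by (cases F)
      have lr: "\<forall>i<m. a \<le> l i \<and> l i \<le> r i \<and> r i \<le> s \<and> {l i<..<r i} \<subseteq> U"
        and disj: "disjoint_family_on (\<lambda>i. {l i<..<r i}) {..<m}"
        using F by (auto simp: fam_def F_eq)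
      \<comment> \<open>The family is extended by \<open>{s<..<t}\<close> as its last member, which
        is disjoint from the others because they end by \<open>s\<close>.\<close>
      let ?G = "(Suc m, l(m := s), r(m := t))"
      have "{l i<..<r i} \<inter> {s<..<t} = {}" if "i < m" for i
        using lr that by fastforce
      with disj have "disjoint_family_on (\<lambda>i. {(l(m := s)) i<..<(r(m := t)) i}) {..<Suc m}"
        unfolding disjoint_family_on_def
        by (auto simp: less_Suc_eq min.commute[of t] max.commute[of s])
      moreover have "\<forall>i<Suc m. a \<le> (l(m := s)) i \<and> (l(m := s)) i \<le> (r(m := t)) i \<and>
          (r(m := t)) i \<le> t \<and> {(l(m := s)) i<..<(r(m := t)) i} \<subseteq> U"
        using lr st by (auto simp: less_Suc_eq intro: order.trans[of _ s])
      ultimately have "?G \<in> fam t"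
        by (simp only: fam_def mem_Collect_eq case_prod_conv simp_thms)
      then have "var ?G \<le> \<phi> t"
        unfolding \<phi>_def using bdd[OF st(3)] by (intro cSUP_upper) auto
      moreover have "var ?G = var F + \<bar>f t - f s\<bar>"
        by (simp add: var_def F_eq)
      ultimately show ?thesis by simp
    qed
    then have "\<phi> s \<le> \<phi> t - \<bar>f t - f s\<bar>"
      unfolding \<phi>_def[of s] using ne by (intro cSUP_least) auto
    then show ?thesis by simp
  qed
  define G where "G t = f a + \<eta> * (t - a) + \<phi> t" for t
  have G_mono: "G s \<le> G t" if "s \<le> t" "t \<le> b" for s t
    unfolding G_def using that \<open>\<eta> > 0\<close> by (intro add_mono mult_left_mono \<phi>_mono) auto
  \<comment> \<open>Supremum argument: the bound holds at \<open>c = Sup S\<close>, and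
    \<open>c < b\<close> would let it hold at some later point as well.\<close>
  define S where "S = {t \<in> {a..b}. f t \<le> G t}"
  have "0 \<le> \<phi> a"
    unfolding \<phi>_def by (rule cSUP_upper2[OF bdd[OF \<open>a \<le> b\<close>], of "(0, \<lambda>_. a, \<lambda>_. a)"])
      (auto simp: fam_def var_def disjoint_family_on_def)
  then have "a \<in> S" using \<open>a \<le> b\<close> by (simp add: S_def G_def)
  have bddS: "bdd_above S" by (auto simp: S_def intro: bdd_aboveI[of _ b])
  define c where "c = Sup S"
  have c_le: "s \<le> c" if "s \<in> S" for s
    unfolding c_def using bddS that by (rule cSup_upper[rotated])
  have "a \<le> c" by (rule c_le) fact
  have "c \<le> b"
    unfolding c_def using \<open>a \<in> S\<close> by (intro cSup_least) (auto simp: S_def)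
  \<comment> \<open>Since \<open>f\<close> is continuous and \<open>G\<close> is nondecreasing, a
    failure at \<open>c\<close> would give \<open>f s > G c \<ge> G s\<close> for points
    \<open>s\<close> of \<open>S\<close> close to \<open>c\<close>.\<close>
  have "f c \<le> G c"
  proof (rule ccontr)
    assume "\<not> f c \<le> G c"
    then have "f c - G c > 0" by simp
    with abs_continuous_on_interval_imp_continuous_on[OF ac] \<open>a \<le> c\<close> \<open>c \<le> b\<close>
    obtain d where "d > 0" and d: "\<And>s. s \<in> {a..b} \<Longrightarrow> dist s c < d \<Longrightarrow> dist (f s) (f c) < f c - G c"
      unfolding continuous_on_iff by (metis atLeastAtMost_iff)
    have "S \<noteq> {}" "c - d < Sup S" using \<open>a \<in> S\<close> \<open>d > 0\<close> by (auto simp: c_def)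
    then obtain s where s: "s \<in> S" "c - d < s"
      using less_cSupE by metis
    with c_le have "s \<le> c" by simp
    with s d[of s] have "f s > G c" by (auto simp: S_def dist_real_def)
    moreover have "f s \<le> G c"
      using G_mono[OF \<open>s \<le> c\<close> \<open>c \<le> b\<close>] s by (simp add: S_def)
    ultimately show False by simp
  qed
  have "c = b"
  proof (rule ccontr)
    assume "c \<noteq> b"
    with \<open>c \<le> b\<close> have "c < b" by simp
    have "\<exists>s. c < s \<and> s < b \<and> f s \<le> G s"
    proof (cases "c \<in> N")
      case True
      with U obtain d where "d > 0" and d: "ball c d \<subseteq> U"
        by (meson openE subsetD)
      define s where "s = min ((b + c) / 2) (c + d / 2)"
      have s: "c < s" "s < b" "s < c + d"
        using \<open>c < b\<close> \<open>d > 0\<close> by (auto simp: s_def min_def)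
      have "{c<..<s} \<subseteq> U"
        using d s by (auto simp: dist_real_def subset_iff)
      then have "\<phi> c + \<bar>f s - f c\<bar> \<le> \<phi> s"
        using s \<open>a \<le> c\<close> by (intro \<phi>_step) auto
      moreover have "\<eta> * (c - a) \<le> \<eta> * (s - a)"
        using s \<open>\<eta> > 0\<close> by (intro mult_left_mono) auto
      ultimately have "f s \<le> G s"
        using \<open>f c \<le> G c\<close> by (simp add: G_def)
      with s show ?thesis by blast
    next
      case False
      have "\<forall>\<^sub>F s in at_right c. f s - f c \<le> \<eta> * (s - c)"
        using dini \<open>a \<le> c\<close> \<open>c < b\<close> False \<open>\<eta> > 0\<close> by blast
      moreover have "\<forall>\<^sub>F s in at_right c. s \<in> {c<..<b}"
        using \<open>c < b\<close> by (rule eventually_at_right_real)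
      ultimately have "\<forall>\<^sub>F s in at_right c. f s - f c \<le> \<eta> * (s - c) \<and> s \<in> {c<..<b}"
        by (rule eventually_conj)
      then obtain s where s: "f s - f c \<le> \<eta> * (s - c)" "c < s" "s < b"
        using eventually_happens'[OF trivial_limit_at_right_real] by fastforce
      have "f s \<le> G s"
        using s \<open>f c \<le> G c\<close> \<phi>_mono[of c s] by (simp add: G_def algebra_simps)
      with s show ?thesis by blast
    qed
    then obtain s where s: "c < s" "s < b" "f s \<le> G s" by blast
    with \<open>a \<le> c\<close> have "s \<in> S" by (simp add: S_def)
    with c_le s show False by fastforce
  qed
  then have "f b \<le> f a + \<eta> * (b - a) + \<phi> b"
    using \<open>f c \<le> G c\<close> by (simp add: G_def)
  then show "f b \<le> f a + e"
    using \<phi>_le[of b] \<eta> by linarith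
qed

section \<open>Step functions on compact sets\<close>

lemma measure_compact_Icc_increment:
  fixes K :: "real set"
  assumes "compact K" "0 \<le> s" "s \<le> t"
  shows "measure lebesgue (K \<inter> {0..t}) - measure lebesgue (K \<inter> {0..s}) = measure lebesgue (K \<inter> {s<..t})"
    and "measure lebesgue (K \<inter> {s<..t}) \<le> t - s"
proof -
  have K: "K \<in> lmeasurable" using assms(1) by (rule lmeasurable_compact)
  have eq: "K \<inter> {0..t} = (K \<inter> {0..s}) \<union> (K \<inter> {s<..t})"
    using assms by auto
  have "measure lebesgue ((K \<inter> {0..s}) \<union> (K \<inter> {s<..t})) =
      measure lebesgue (K \<inter> {0..s}) + measure lebesgue (K \<inter> {s<..t})"
    using K by (intro measure_Un_AE fmeasurable_Int_fmeasurable AE_I2) auto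
  then show "measure lebesgue (K \<inter> {0..t}) - measure lebesgue (K \<inter> {0..s}) = measure lebesgue (K \<inter> {s<..t})"
    using eq by simp
  have Ioc: "{s<..t} \<in> lmeasurable"
    by (intro bounded_set_imp_lmeasurable) auto
  then have "measure lebesgue (K \<inter> {s<..t}) \<le> measure lebesgue {s<..t}"
    using K by (intro measure_mono_fmeasurable) auto
  then show "measure lebesgue (K \<inter> {s<..t}) \<le> t - s"
    using assms(3) by simp
qed

text \<open>The integral over \<open>{0..t}\<close> of the step function with value \<open>y\<close> on \<open>K y\<close>; the steps are
  indexed by their values.\<close>

definition step_integral :: "real set \<Rightarrow> (real \<Rightarrow> real set) \<Rightarrow> real \<Rightarrow> real" where
  "step_integral J K t = (\<Sum>y\<in>J. y * measure lebesgue (K y \<inter> {0..t}))"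

lemma step_integral_increment:
  assumes "\<And>y. y \<in> J \<Longrightarrow> compact (K y)" "0 \<le> s" "s \<le> t"
  shows "step_integral J K t - step_integral J K s = (\<Sum>y\<in>J. y * measure lebesgue (K y \<inter> {s<..t}))"
  unfolding step_integral_def sum_subtractf[symmetric] right_diff_distrib[symmetric]
  using assms by (intro sum.cong refl) (simp add: measure_compact_Icc_increment(1))

text \<open>Serves to show that adding a step integral preserves absolute continuity, for which the
  crude constant, the sum of all step values, is enough.\<close>

lemma step_integral_Lipschitz:
  assumes "\<And>y. y \<in> J \<Longrightarrow> compact (K y) \<and> 0 \<le> y" "0 \<le> s" "s \<le> t"
  shows "\<bar>step_integral J K t - step_integral J K s\<bar> \<le> (\<Sum>y\<in>J. y) * (t - s)"
proof -
  have "step_integral J K t - step_integral J K s = (\<Sum>y\<in>J. y * measure lebesgue (K y \<inter> {s<..t}))"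
    using assms by (intro step_integral_increment) auto
  moreover have "\<dots> \<le> (\<Sum>y\<in>J. y * (t - s))"
    using assms by (intro sum_mono mult_left_mono measure_compact_Icc_increment(2)) auto
  moreover have "\<dots> = (\<Sum>y\<in>J. y) * (t - s)"
    by (simp add: sum_distrib_right)
  moreover have "(\<Sum>y\<in>J. y * measure lebesgue (K y \<inter> {s<..t})) \<ge> 0"
    using assms by (intro sum_nonneg) auto
  ultimately show ?thesis by simp
qed

text \<open>Upper semicontinuity of the step function: the sets are closed, so those avoiding
  \<open>t\<close> also avoid a right neighbourhood of \<open>t\<close>, and by disjointness at most
  one step remains.\<close>

lemma step_integral_right_increment_le:
  assumes "finite J" and K: "\<And>y. y \<in> J \<Longrightarrow> compact (K y) \<and> 0 \<le> y"
    and disj: "disjoint_family_on K J" and "0 \<le> t" "0 \<le> B"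
    and B: "\<And>y. y \<in> J \<Longrightarrow> t \<in> K y \<Longrightarrow> y \<le> B"
  shows "\<forall>\<^sub>F s in at_right t. step_integral J K s - step_integral J K t \<le> B * (s - t)"
proof -
  have ev: "\<forall>\<^sub>F s in at_right t. K y \<inter> {t<..s} = {}" if "y \<in> J" "t \<notin> K y" for y
  proof -
    have "open (- K y)" using K that by (simp add: compact_imp_closed open_Compl)
    with \<open>t \<notin> K y\<close> obtain d where "d > 0" and d: "ball t d \<subseteq> - K y"
      by (meson ComplI openE)
    have "K y \<inter> {t<..s} = {}" if "t < s" "s < t + d" for s
      using d that by (auto simp: subset_iff dist_real_def)
    with \<open>d > 0\<close> show ?thesis
      unfolding eventually_at_right_field by (intro exI[of _ "t + d"]) auto
  qed
  have "\<forall>\<^sub>F s in at_right t. \<forall>y\<in>{y\<in>J. t \<notin> K y}. K y \<inter> {t<..s} = {}"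
    using \<open>finite J\<close> ev by (intro eventually_ball_finite) auto
  moreover have "\<forall>\<^sub>F s in at_right t. t < s"
    by (simp add: eventually_at_filter)
  ultimately show ?thesis
  proof eventually_elim
    case (elim s)
    let ?H = "{y\<in>J. t \<in> K y}"
    \<comment> \<open>If no set contains \<open>t\<close>, the sum is empty and
      \<open>0 \<le> B\<close> covers it.\<close>
    have "card ?H \<le> 1"
      using disj \<open>finite J\<close> by (auto simp: card_le_Suc0_iff_eq disjoint_family_on_def)
    then have sumB: "(\<Sum>y\<in>?H. y) \<le> B"
      using \<open>finite J\<close> B \<open>0 \<le> B\<close> sum_bounded_above[of ?H "\<lambda>y. y" B]
      by (cases "card ?H = 0") (auto simp: le_Suc_eq)
    have "step_integral J K s - step_integral J K t = (\<Sum>y\<in>J. y * measure lebesgue (K y \<inter> {t<..s}))"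
      using K elim \<open>0 \<le> t\<close> by (intro step_integral_increment) auto
    also have "\<dots> = (\<Sum>y\<in>?H. y * measure lebesgue (K y \<inter> {t<..s}))"
      using \<open>finite J\<close> elim by (intro sum.mono_neutral_right) auto
    also have "\<dots> \<le> (\<Sum>y\<in>?H. y * (s - t))"
      using K elim \<open>0 \<le> t\<close> by (intro sum_mono mult_left_mono measure_compact_Icc_increment(2)) auto
    also have "\<dots> = (\<Sum>y\<in>?H. y) * (s - t)"
      by (simp add: sum_distrib_right)
    also have "\<dots> \<le> B * (s - t)"
      using sumB elim by (intro mult_right_mono) auto
    finally show ?case .
  qed
qed

text \<open>Up to a null set, \<open>S\<close> is an F-sigma set, hence a countable union of compact
  sets; its finite partial unions increase to it and measure is continuous from below.\<close>

lemma lebesgue_compact_exhaustion: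
  fixes S :: "'a::euclidean_space set"
  assumes "S \<in> sets lebesgue"
  obtains F :: "nat \<Rightarrow> 'a set" where "\<And>n. compact (F n)" "\<And>n. F n \<subseteq> S"
    "(\<lambda>n. emeasure lebesgue (F n)) \<longlonglongrightarrow> emeasure lebesgue S"
proof -
  obtain D T where D: "fsigma D" "T \<in> null_sets lebesgue" "D \<union> T = S" "disjnt D T"
    using lebesgue_set_almost_fsigma[OF assms] .
  obtain G :: "nat \<Rightarrow> 'a set" where G: "range G \<subseteq> Collect compact" "D = \<Union>(range G)"
    using D(1) unfolding fsigma_Union_compact by blast
  define F where "F n = (\<Union>i\<le>n. G i)" for n
  have comp: "compact (F n)" for n
    using G(1) unfolding F_def by (intro compact_UN) auto
  have "incseq F" unfolding F_def incseq_def by fastforce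
  have UF: "(\<Union>n. F n) = D" unfolding F_def G(2) by auto
  have "range F \<subseteq> sets lebesgue"
    using comp by (auto intro: lmeasurable_compact fmeasurableD)
  then have "(\<lambda>n. emeasure lebesgue (F n)) \<longlonglongrightarrow> emeasure lebesgue (\<Union>n. F n)"
    using \<open>incseq F\<close> by (rule Lim_emeasure_incseq)
  moreover have "emeasure lebesgue S = emeasure lebesgue D"
  proof -
    have "D \<in> sets lebesgue" using UF \<open>range F \<subseteq> sets lebesgue\<close> by (metis sets.countable_UN)
    then show ?thesis using D(2,3) by (metis emeasure_Un_null_set)
  qed
  moreover have "F n \<subseteq> S" for n
    using UF D(3) by blast
  ultimately show ?thesis using that comp UF by metis
qed

text \<open>The integral is a supremum over simple functions below \<open>f\<close>, whose level sets are exhausted by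
  compact sets.\<close>

lemma nn_integral_le_compact_steps:
  fixes f :: "real \<Rightarrow> real"
  assumes bound: "\<And>J K. \<lbrakk>finite J; \<And>y. y \<in> J \<Longrightarrow> compact (K y) \<and> 0 \<le> y; disjoint_family_on K J;
      \<And>y t. y \<in> J \<Longrightarrow> t \<in> K y \<Longrightarrow> 0 \<le> t \<and> y \<le> f t\<rbrakk>
      \<Longrightarrow> (\<Sum>y\<in>J. y * measure lebesgue (K y)) \<le> B"
    and nonneg: "\<And>t. 0 \<le> f t"
  shows "(\<integral>\<^sup>+t. ennreal (f t) \<partial>lebesgue_on {0..}) \<le> ennreal B"
  unfolding nn_integral_def_finite
proof (rule SUP_least, clarify)
  fix g assume g: "simple_function (lebesgue_on {0..}) g" "g \<le> (\<lambda>t. ennreal (f t))" "\<forall>t. g t < top"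
  define R where "R = g ` {0..}"
  define D where "D y = g -` {y} \<inter> {0..}" for y
  have "finite R"
    using simple_functionD(1)[OF g(1)] by (simp add: R_def)
  have D: "D y \<in> sets lebesgue" for y
    using simple_functionD(2)[OF g(1), of "{y}"] 
    by (simp add: D_def sets_restrict_space_iff)
  have "\<exists>F. (\<forall>n. compact (F n) \<and> F n \<subseteq> D y) \<and>
      (\<lambda>n::nat. emeasure lebesgue (F n)) \<longlonglongrightarrow> emeasure lebesgue (D y)" for y
    using lebesgue_compact_exhaustion[OF D] by metis
  then obtain F where F: "\<And>y n. compact (F y n)" "\<And>y n. F y n \<subseteq> D y"
      "\<And>y. (\<lambda>n::nat. emeasure lebesgue (F y n)) \<longlonglongrightarrow> emeasure lebesgue (D y)"
    by metis
  \<comment> \<open>Finite values make multiplication by \<open>y\<close> continuous on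
    \<open>ennreal\<close> and make \<open>enn2real\<close> injective on \<open>R\<close>.\<close>
  have fin: "y < top" if "y \<in> R" for y
    using g(3) that by (auto simp: R_def)
  have "(\<lambda>n. \<Sum>y\<in>R. y * emeasure lebesgue (F y n)) \<longlonglongrightarrow> (\<Sum>y\<in>R. y * emeasure lebesgue (D y))"
    using fin F(3) by (intro tendsto_sum ennreal_tendsto_cmult) auto
  moreover have "(\<Sum>y\<in>R. y * emeasure lebesgue (F y n)) \<le> ennreal B" for n
  proof -
    \<comment> \<open>The steps are reindexed by real values, as \<open>bound\<close> requires;
      distinct values have disjoint level sets.\<close>
    let ?K = "\<lambda>y. F (ennreal y) n"
    have inj: "inj_on enn2real R"
      using fin by (intro inj_onI) (metis ennreal_enn2real)
    have "y * emeasure lebesgue (F y n) = ennreal (enn2real y * measure lebesgue (?K (enn2real y)))"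
      if "y \<in> R" for y
      using fin[OF that] lmeasurable_compact[OF F(1)[of y n]]
      by (simp add: ennreal_mult emeasure_eq_measure2)
    then have "(\<Sum>y\<in>R. y * emeasure lebesgue (F y n)) =
        (\<Sum>y\<in>R. ennreal (enn2real y * measure lebesgue (?K (enn2real y))))"
      by (intro sum.cong) auto
    also have "\<dots> = ennreal (\<Sum>y\<in>R. enn2real y * measure lebesgue (?K (enn2real y)))"
      by (intro sum_ennreal) auto
    also have "(\<Sum>y\<in>R. enn2real y * measure lebesgue (?K (enn2real y))) =
        (\<Sum>y\<in>enn2real ` R. y * measure lebesgue (?K y))"
      using inj by (simp add: sum.reindex)
    also have "\<dots> \<le> B"
    proof (rule bound)
      show "finite (enn2real ` R)" using \<open>finite R\<close> by simp
      show "compact (?K y) \<and> 0 \<le> y" if "y \<in> enn2real ` R" for y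
        using F(1) that by auto
      show "disjoint_family_on ?K (enn2real ` R)"
        unfolding disjoint_family_on_def
      proof (clarify)
        fix a b assume "a \<in> R" "b \<in> R" "enn2real a \<noteq> enn2real b"
        then have "D (ennreal (enn2real a)) \<inter> D (ennreal (enn2real b)) = {}"
          using fin by (auto simp: D_def)
        then show "?K (enn2real a) \<inter> ?K (enn2real b) = {}"
          using F(2) by blast
      qed
      show "0 \<le> t \<and> y \<le> f t" if "y \<in> enn2real ` R" "t \<in> ?K y" for y t
      proof -
        have "g t = ennreal y" "0 \<le> t" using F(2)[of "ennreal y" n] that(2) by (auto simp: D_def)
        moreover have "g t \<le> ennreal (f t)" using g(2) by (simp add: le_fun_def)
        ultimately show ?thesis using nonneg[of t] by simp
      qed
    qed
    finally show ?thesis by (auto intro: ennreal_leI)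
  qed
  ultimately have "(\<Sum>y\<in>R. y * emeasure lebesgue (D y)) \<le> ennreal B"
    by (intro LIMSEQ_le_const2) auto
  moreover have "emeasure (lebesgue_on {0..}) (D y) = emeasure lebesgue (D y)" for y
    by (subst emeasure_restrict_space) (auto simp: D_def)
  ultimately show "integral\<^sup>S (lebesgue_on {0..}) g \<le> ennreal B"
    unfolding simple_integral_def R_def D_def by simp
qed

section \<open>Quadratic forms and the switching rule\<close>

text \<open>The constant is the minimum of the form on the compact unit sphere; homogeneity of
  degree two extends the bound to all vectors.\<close>

lemma quadratic_form_lower_bound:
  fixes M :: "real^'n^'n"
  assumes "\<And>x. x \<noteq> 0 \<Longrightarrow> 0 < x \<bullet> (M *v x)"
  obtains c where "0 < c" "\<And>x. c * (norm x)\<^sup>2 \<le> x \<bullet> (M *v x)"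
proof -
  have cont: "continuous_on (sphere 0 1) (\<lambda>x::real^'n. x \<bullet> (M *v x))"
    by (intro continuous_intros)
  have "sphere (0::real^'n) 1 \<noteq> {}"
    by simp
  then obtain u where u: "u \<in> sphere 0 1" and min: "\<And>y. y \<in> sphere 0 1 \<Longrightarrow> u \<bullet> (M *v u) \<le> y \<bullet> (M *v y)"
    using continuous_attains_inf[OF compact_sphere _ cont] by blast
  show thesis
  proof
    have "u \<noteq> 0" using u by auto
    then show "0 < u \<bullet> (M *v u)" by (rule assms)
    show "(u \<bullet> (M *v u)) * (norm x)\<^sup>2 \<le> x \<bullet> (M *v x)" for x
    proof (cases "x = 0")
      case False
      let ?y = "x /\<^sub>R norm x"
      have "x = norm x *\<^sub>R ?y" using False by simp
      then have "x \<bullet> (M *v x) = (norm x)\<^sup>2 * (?y \<bullet> (M *v ?y))"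
        by (metis inner_scaleR_left inner_scaleR_right matrix_vector_mult_scaleR mult.assoc power2_eq_square)
      moreover have "?y \<in> sphere 0 1" using False by simp
      ultimately show ?thesis
        using mult_left_mono[OF min[of ?y], of "(norm x)\<^sup>2"] by (simp add: mult.commute)
    qed simp
  qed
qed

lemma quadratic_forms_lower_bound:
  fixes M :: "'i \<Rightarrow> real^'n^'n"
  assumes "finite I" "\<And>i x. i \<in> I \<Longrightarrow> x \<noteq> 0 \<Longrightarrow> 0 < x \<bullet> (M i *v x)"
  obtains c where "0 < c" "\<And>i x. i \<in> I \<Longrightarrow> c * (norm x)\<^sup>2 \<le> x \<bullet> (M i *v x)"
proof -
  have "\<exists>c>0. \<forall>x. c * (norm x)\<^sup>2 \<le> x \<bullet> (M i *v x)" if "i \<in> I" for i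
    using quadratic_form_lower_bound[of "M i"] assms(2) that by metis
  then obtain c where c: "\<And>i. i \<in> I \<Longrightarrow> 0 < c i" "\<And>i x. i \<in> I \<Longrightarrow> c i * (norm x)\<^sup>2 \<le> x \<bullet> (M i *v x)"
    by metis
  \<comment> \<open>The inserted 1 makes the minimum well defined and positive also for empty
    \<open>I\<close>.\<close>
  define d where "d = Min (insert 1 (c ` I))"
  show thesis
  proof
    show "0 < d" using assms(1) c(1) by (simp add: d_def)
    show "d * (norm x)\<^sup>2 \<le> x \<bullet> (M i *v x)" if "i \<in> I" for i x
    proof -
      have "d \<le> c i" using assms(1) that by (auto simp: d_def)
      then have "d * (norm x)\<^sup>2 \<le> c i * (norm x)\<^sup>2" by (intro mult_right_mono) auto
      with c(2)[OF that, of x] show ?thesis by simp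
    qed
  qed
qed

lemma bilinear_forms_upper_bound:
  fixes M :: "'i \<Rightarrow> real^'n^'n"
  assumes "finite I"
  obtains K where "0 < K" "\<And>i x y. i \<in> I \<Longrightarrow> \<bar>x \<bullet> (M i *v y)\<bar> \<le> K * norm x * norm y"
proof
  \<comment> \<open>The sum of the operator norms dominates each of them, and the 1 makes the
    constant strictly positive.\<close>
  let ?K = "1 + (\<Sum>i\<in>I. onorm ((*v) (M i)))"
  have bl: "bounded_linear ((*v) (M i))" for i
    by (rule matrix_vector_mul_bounded_linear)
  then have pos: "0 \<le> onorm ((*v) (M i))" for i by (rule onorm_pos_le)
  show "0 < ?K" using pos by (simp add: add_pos_nonneg sum_nonneg)
  show "\<bar>x \<bullet> (M i *v y)\<bar> \<le> ?K * norm x * norm y" if "i \<in> I" for i x y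
  proof -
    have "onorm ((*v) (M i)) \<le> (\<Sum>i\<in>I. onorm ((*v) (M i)))"
      using assms that pos by (intro member_le_sum) auto
    then have "onorm ((*v) (M i)) \<le> ?K" by simp
    have "\<bar>x \<bullet> (M i *v y)\<bar> \<le> norm x * norm (M i *v y)"
      by (rule Cauchy_Schwarz_ineq2)
    also have "\<dots> \<le> norm x * (onorm ((*v) (M i)) * norm y)"
      by (intro mult_left_mono onorm bl) auto
    also have "\<dots> \<le> norm x * (?K * norm y)"
      using \<open>onorm ((*v) (M i)) \<le> ?K\<close> by (intro mult_left_mono mult_right_mono) auto
    finally show ?thesis by (simp add: mult.assoc mult.left_commute)
  qed
qed

lemma inner_transpose_mult:
  fixes M :: "real^'n^'m"
  shows "x \<bullet> ((transpose M ** Q) *v y) = (M *v x) \<bullet> (Q *v y)"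
  by (metis dot_lmul_matrix matrix_vector_mul_assoc transpose_matrix_vector transpose_transpose)

text \<open>Writes the trace through the vectors \<open>E *v axis k 1\<close>, which are the initial
  states of the impulse responses.\<close>

lemma trace_transpose_mult:
  fixes E :: "real^'q^'n" and Q :: "real^'n^'n"
  shows "trace (transpose E ** Q ** E) = (\<Sum>k\<in>UNIV. (E *v axis k 1) \<bullet> (Q *v (E *v axis k 1)))"
proof -
  have "(transpose E ** Q ** E) $ k $ k = axis k 1 \<bullet> ((transpose E ** (Q ** E)) *v axis k 1)" for k
    by (simp add: matrix_vector_mult_basis column_def inner_axis' matrix_mul_assoc)
  then show ?thesis
    by (simp add: trace_def inner_transpose_mult matrix_vector_mul_assoc)
qed

lemma sum_matrix_vector_mult:
  fixes M :: "'i \<Rightarrow> real^'n^'m"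
  shows "(\<Sum>i\<in>S. M i) *v x = (\<Sum>i\<in>S. M i *v x)"
  by (induction S rule: infinite_finite_induct) (auto simp: matrix_vector_mult_add_rdistrib)

text \<open>Convexity of the squared norm: the weighted variance of the \<open>z i\<close> about
  their mean \<open>w\<close> is nonnegative.\<close>

lemma inner_convex_combination_le:
  fixes z :: "'i \<Rightarrow> 'a::real_inner"
  assumes "\<And>i. i \<in> I \<Longrightarrow> 0 \<le> a i" "(\<Sum>i\<in>I. a i) = 1"
  shows "(\<Sum>i\<in>I. a i *\<^sub>R z i) \<bullet> (\<Sum>i\<in>I. a i *\<^sub>R z i) \<le> (\<Sum>i\<in>I. a i * (z i \<bullet> z i))"
proof -
  define w where "w = (\<Sum>i\<in>I. a i *\<^sub>R z i)"
  have "0 \<le> (\<Sum>i\<in>I. a i * ((z i - w) \<bullet> (z i - w)))"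
    using assms(1) by (intro sum_nonneg) auto
  also have "\<dots> = (\<Sum>i\<in>I. a i * (z i \<bullet> z i)) - 2 * (\<Sum>i\<in>I. (a i *\<^sub>R z i) \<bullet> w) + (\<Sum>i\<in>I. a i) * (w \<bullet> w)"
    unfolding sum_distrib_left sum_distrib_right sum_subtractf[symmetric] sum.distrib[symmetric]
    by (intro sum.cong refl) (simp add: inner_diff inner_commute algebra_simps)
  also have "(\<Sum>i\<in>I. (a i *\<^sub>R z i) \<bullet> w) = w \<bullet> w"
    by (simp only: inner_sum_left[symmetric] w_def[symmetric])
  finally show ?thesis using assms(2) by (simp add: w_def)
qed

section \<open>The switching rule and its Lyapunov function\<close>

lemma min_switching_is_arg_min:
  assumes "1 \<le> N"
  shows "min_switching N P x \<in> {1..N}"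
    and "j \<in> {1..N} \<Longrightarrow> x \<bullet> (P (min_switching N P x) *v x) \<le> x \<bullet> (P j *v x)"
proof -
  let ?S = "{i. is_arg_min (\<lambda>i. x \<bullet> (P i *v x)) (\<lambda>i. i \<in> {1..N}) i}"
  have "finite ?S" by (rule finite_subset[of _ "{1..N}"]) (auto simp: is_arg_min_linorder)
  moreover have "?S \<noteq> {}"
    using ex_is_arg_min_if_finite[of "{1..N}" "\<lambda>i. x \<bullet> (P i *v x)"] assms by auto
  ultimately have "min_switching N P x \<in> ?S"
    unfolding min_switching_def by (rule Min_in)
  then show "min_switching N P x \<in> {1..N}"
    and "j \<in> {1..N} \<Longrightarrow> x \<bullet> (P (min_switching N P x) *v x) \<le> x \<bullet> (P j *v x)"
    by (auto simp: is_arg_min_linorder)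
qed

text \<open>The inequality holds on the region of mode \<open>i\<close> and defines a closed set, so
  it passes to the closure of that region, which contains every point where \<open>i\<close> is
  active. Hence all modes of a sliding motion attain the minimum.\<close>

lemma active_modes_min_switching_le:
  fixes P :: "nat \<Rightarrow> real^'n^'n"
  assumes "1 \<le> N" "i \<in> active_modes N (min_switching N P) x" "j \<in> {1..N}"
  shows "x \<bullet> (P i *v x) \<le> x \<bullet> (P j *v x)"
proof -
  let ?S = "{y. y \<bullet> (P i *v y) \<le> y \<bullet> (P j *v y)}"
  have "closed ?S"
    by (intro closed_Collect_le continuous_intros)
  moreover have "mode_region (min_switching N P) i \<subseteq> ?S"
    using min_switching_is_arg_min(2)[OF assms(1,3)] by (auto simp: mode_region_def)
  moreover have "x \<in> closure (mode_region (min_switching N P) i)"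
    using assms(2) by (auto simp: active_modes_def closure_iff_nhds_not_empty)
  ultimately show ?thesis
    using closure_minimal by blast
qed

text \<open>The minimum is written through the switching rule, so that it is by definition the value
  of the quadratic form of the mode selected at \<open>x\<close>.\<close>

definition min_lyapunov :: "nat \<Rightarrow> (nat \<Rightarrow> real^'n^'n) \<Rightarrow> real^'n \<Rightarrow> real" where
  "min_lyapunov N P x = x \<bullet> (P (min_switching N P x) *v x)"

lemma min_lyapunov_le:
  "\<lbrakk>1 \<le> N; j \<in> {1..N}\<rbrakk> \<Longrightarrow> min_lyapunov N P x \<le> x \<bullet> (P j *v x)"
  unfolding min_lyapunov_def by (rule min_switching_is_arg_min)

text \<open>The form of the mode selected at \<open>x\<close> is exact at \<open>x\<close> and an
  upper bound at \<open>y\<close>, so the increment is at most that of one quadratic form;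
  exchanging \<open>x\<close> and \<open>y\<close> gives the other direction.\<close>

lemma min_lyapunov_Lipschitz:
  fixes P :: "nat \<Rightarrow> real^'n^'n"
  assumes "1 \<le> N" and K: "\<And>i x y. i \<in> {1..N} \<Longrightarrow> \<bar>x \<bullet> (P i *v y)\<bar> \<le> K * norm x * norm y"
    and "0 \<le> K" "norm x \<le> R" "norm y \<le> R"
  shows "\<bar>min_lyapunov N P y - min_lyapunov N P x\<bar> \<le> 2 * K * R * norm (y - x)"
proof -
  have *: "min_lyapunov N P y - min_lyapunov N P x \<le> 2 * K * R * norm (y - x)"
    if "norm x \<le> R" "norm y \<le> R" for x y
  proof -
    let ?i = "min_switching N P x"
    have i: "?i \<in> {1..N}" using assms(1) by (rule min_switching_is_arg_min)
    have "min_lyapunov N P y - min_lyapunov N P x \<le> y \<bullet> (P ?i *v y) - x \<bullet> (P ?i *v x)"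
      using min_lyapunov_le[OF assms(1) i, of P y] by (simp add: min_lyapunov_def)
    also have "\<dots> = y \<bullet> (P ?i *v (y - x)) + (y - x) \<bullet> (P ?i *v x)"
      by (simp add: matrix_vector_mult_diff_distrib inner_diff)
    also have "\<dots> \<le> K * norm y * norm (y - x) + K * norm (y - x) * norm x"
      using K[OF i, of y "y - x"] K[OF i, of "y - x" x] by linarith
    also have "\<dots> \<le> K * R * norm (y - x) + K * norm (y - x) * R"
      using that \<open>0 \<le> K\<close> by (intro add_mono mult_left_mono mult_right_mono) auto
    finally show ?thesis by (simp add: mult.assoc mult.commute mult.left_commute)
  qed
  from *[OF assms(4,5)] *[OF assms(5,4)] show ?thesis
    by (simp add: abs_le_iff norm_minus_commute)
qed

lemma quadratic_form_has_vector_derivative: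
  fixes x :: "real \<Rightarrow> real^'n"
  assumes "(x has_vector_derivative d) (at t within S)"
  shows "((\<lambda>s. x s \<bullet> (P i *v x s)) has_vector_derivative vdot P i (x t) d) (at t within S)"
proof -
  have "((\<lambda>s. P i *v x s) has_vector_derivative P i *v d) (at t within S)"
    by (rule bounded_linear.has_vector_derivative[OF matrix_vector_mul_bounded_linear assms])
  from bounded_bilinear.has_vector_derivative[OF bounded_bilinear_inner assms this]
  show ?thesis by (simp add: vdot_def)
qed

lemma vdot_scaleR: "vdot P i x (a *\<^sub>R d) = a * vdot P i x d"
  by (simp add: vdot_def matrix_vector_mult_scaleR distrib_left)

text \<open>The column sums of \<open>\<pi>\<close> vanish and its off-diagonal entries are nonnegative, so the coupling
  term is nonnegative at any point where mode \<open>i\<close> attains the minimum.\<close>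

lemma metzler_coupling_nonneg:
  assumes "\<pi> \<in> metzler_zero_colsum N" "i \<in> {1..N}" "\<And>j. j \<in> {1..N} \<Longrightarrow> v i \<le> v j"
  shows "0 \<le> (\<Sum>j=1..N. \<pi> j i * v j)"
proof -
  have "0 = (\<Sum>j=1..N. \<pi> j i) * v i"
    using assms(1,2) by (simp add: metzler_zero_colsum_def)
  also have "\<dots> = (\<Sum>j=1..N. \<pi> j i * v i)"
    by (rule sum_distrib_right)
  also have "\<dots> \<le> (\<Sum>j=1..N. \<pi> j i * v j)"
  proof (rule sum_mono)
    fix j assume j: "j \<in> {1..N}"
    show "\<pi> j i * v i \<le> \<pi> j i * v j"
      using assms j by (cases "j = i") (auto simp: metzler_zero_colsum_def intro: mult_left_mono)
  qed
  finally show ?thesis .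
qed

section \<open>Dissipation along solutions\<close>

text \<open>The strict matrix inequalities enter through a single margin \<open>c\<close>, common to
  all of the finitely many modes.\<close>

locale lyapunov_metzler =
  fixes N :: nat and A :: "nat \<Rightarrow> real^'n^'n" and C :: "nat \<Rightarrow> real^'n^'p"
    and P :: "nat \<Rightarrow> real^'n^'n" and \<pi> :: "nat \<Rightarrow> nat \<Rightarrow> real" and c :: real
  assumes N: "1 \<le> N"
    and metzler: "\<pi> \<in> metzler_zero_colsum N"
    and P_pos: "\<And>i. i \<in> {1..N} \<Longrightarrow> pos_definite (P i)"
    and c_pos: "0 < c"
    and lmi: "\<And>i x. i \<in> {1..N} \<Longrightarrow>
      x \<bullet> ((transpose (A i) ** P i + P i ** A i + (\<Sum>j=1..N. \<pi> j i *\<^sub>R P j) + transpose (C i) ** C i) *v x)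
        \<le> - c * (norm x)\<^sup>2"
begin

abbreviation "\<sigma> \<equiv> min_switching N P"
abbreviation "v \<equiv> min_lyapunov N P"
abbreviation "I x \<equiv> active_modes N \<sigma> x"

text \<open>An active mode attains the minimum, so the coupling term is nonnegative and may be
  dropped from the matrix inequality.\<close>

lemma mode_dissipation:
  assumes "i \<in> I x"
  shows "vdot P i x (A i *v x) \<le> - c * (norm x)\<^sup>2 - (C i *v x) \<bullet> (C i *v x)"
proof -
  have i: "i \<in> {1..N}" using assms by (simp add: active_modes_def)
  have "0 \<le> (\<Sum>j=1..N. \<pi> j i * (x \<bullet> (P j *v x)))"
    using metzler i active_modes_min_switching_le[OF N assms] by (intro metzler_coupling_nonneg)
  moreover have "x \<bullet> ((\<Sum>j=1..N. \<pi> j i *\<^sub>R P j) *v x) = (\<Sum>j=1..N. \<pi> j i * (x \<bullet> (P j *v x)))"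
    by (simp add: sum_matrix_vector_mult inner_sum_right scaleR_matrix_vector_assoc[symmetric])
  moreover have "vdot P i x (A i *v x) = x \<bullet> ((transpose (A i) ** P i + P i ** A i) *v x)"
    by (simp add: vdot_def matrix_vector_mult_add_rdistrib inner_add_right inner_transpose_mult
        matrix_vector_mul_assoc)
  ultimately show ?thesis
    using lmi[OF i, of x]
    by (simp add: matrix_vector_mult_add_rdistrib inner_add_right inner_transpose_mult)
qed

text \<open>The mode bounds are averaged with the weights; convexity then replaces the mean of the
  squared outputs by the square of the mean output, which is the modified output.\<close>

lemma convexified_dissipation:
  assumes "\<And>i. i \<in> I x \<Longrightarrow> 0 \<le> a i" "(\<Sum>i\<in>I x. a i) = 1"
  shows "(\<Sum>i\<in>I x. vdot P i x (a i *\<^sub>R (A i *v x))) \<le>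
    - c * (norm x)\<^sup>2 - (\<Sum>i\<in>I x. a i *\<^sub>R (C i *v x)) \<bullet> (\<Sum>i\<in>I x. a i *\<^sub>R (C i *v x))"
proof -
  have "(\<Sum>i\<in>I x. vdot P i x (a i *\<^sub>R (A i *v x))) \<le>
      (\<Sum>i\<in>I x. a i * (- c * (norm x)\<^sup>2 - (C i *v x) \<bullet> (C i *v x)))"
    unfolding vdot_scaleR using assms(1) mode_dissipation by (intro sum_mono mult_left_mono) auto
  also have "\<dots> = (\<Sum>i\<in>I x. a i) * (- c * (norm x)\<^sup>2) - (\<Sum>i\<in>I x. a i * ((C i *v x) \<bullet> (C i *v x)))"
    by (simp only: right_diff_distrib sum_subtractf sum_distrib_right)
  also have "\<dots> \<le> - c * (norm x)\<^sup>2 - (\<Sum>i\<in>I x. a i *\<^sub>R (C i *v x)) \<bullet> (\<Sum>i\<in>I x. a i *\<^sub>R (C i *v x))"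
    using inner_convex_combination_le[OF assms, of "\<lambda>i. C i *v x"] assms(2) by simp
  finally show ?thesis .
qed

lemma min_lyapunov_nonneg: "0 \<le> v x"
proof (cases "x = 0")
  case False
  then show ?thesis
    using P_pos[OF min_switching_is_arg_min(1)[OF N], of P x]
    by (auto simp: min_lyapunov_def pos_definite_def intro: less_imp_le)
qed (simp add: min_lyapunov_def)

section \<open>Estimates along a fixed undisturbed solution\<close>

context
  fixes E :: "real^'q^'n" and F :: "nat \<Rightarrow> real^'q^'p"
    and x :: "real \<Rightarrow> real^'n" and \<alpha> :: "nat \<Rightarrow> real^'n \<Rightarrow> real"
  assumes sol: "closed_loop_solution N A (\<lambda>i. E) P \<sigma> (\<lambda>t. 0) x \<alpha>"
begin

abbreviation "z \<equiv> modified_output N C F \<sigma> (\<lambda>t. 0) x \<alpha>"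

lemma solution_continuous_on: "continuous_on {0..T} x"
proof (cases "0 \<le> T")
  case True
  with sol have "abs_continuous_on_interval 0 T x"
    by (auto simp: closed_loop_solution_def abs_continuous_halfline_def)
  then show ?thesis by (rule abs_continuous_on_interval_imp_continuous_on)
qed simp

text \<open>\<open>W\<close> is the quadratic form of the mode selected at time \<open>t\<close>,
  with that mode kept fixed. It touches \<open>v\<close> from above at \<open>t\<close>, so its
  derivative controls the growth of \<open>v\<close> to the right although \<open>v\<close> itself
  may fail to be differentiable.\<close>

lemma min_lyapunov_right_upper_derivative:
  obtains Z where "Z \<in> null_sets lebesgue"
    "\<And>t. 0 \<le> t \<Longrightarrow> t \<notin> Z \<Longrightarrow> \<exists>W D. (W has_vector_derivative D) (at t within {0..}) \<and>
       W t = v (x t) \<and> (\<forall>s. v (x s) \<le> W s) \<and> D \<le> - c * (norm (x t))\<^sup>2 - z t \<bullet> z t"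
proof -
  let ?d = "\<lambda>t. \<Sum>i\<in>I (x t). \<alpha> i (x t) *\<^sub>R (A i *v x t)"
  have "AE t in lebesgue_on {0..}. (\<forall>i\<in>I (x t). 0 \<le> \<alpha> i (x t)) \<and> (\<Sum>i\<in>I (x t). \<alpha> i (x t)) = 1 \<and>
      (x has_vector_derivative ?d t) (at t within {0..}) \<and>
      vdot P (\<sigma> (x t)) (x t) (?d t) \<le> (\<Sum>i\<in>I (x t). vdot P i (x t) (\<alpha> i (x t) *\<^sub>R (A i *v x t)))"
    (is "AE t in _. ?Q t")
    using sol by (simp add: closed_loop_solution_def mode_field_def)
  then have "AE t in lebesgue. t \<in> {0..} \<longrightarrow> ?Q t"
    by (subst (asm) AE_restrict_space_iff) auto
  then obtain Z where Z: "Z \<in> null_sets lebesgue" "{t\<in>space lebesgue. \<not> (t \<in> {0..} \<longrightarrow> ?Q t)} \<subseteq> Z"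
    unfolding eventually_ae_filter by blast
  have "\<exists>W D. (W has_vector_derivative D) (at t within {0..}) \<and>
       W t = v (x t) \<and> (\<forall>s. v (x s) \<le> W s) \<and> D \<le> - c * (norm (x t))\<^sup>2 - z t \<bullet> z t"
    if t: "0 \<le> t" "t \<notin> Z" for t
  proof (intro exI conjI allI)
    have Q: "?Q t" using Z(2) t by auto
    then show "((\<lambda>s. x s \<bullet> (P (\<sigma> (x t)) *v x s)) has_vector_derivative vdot P (\<sigma> (x t)) (x t) (?d t))
        (at t within {0..})"
      by (intro quadratic_form_has_vector_derivative) auto
    show "x t \<bullet> (P (\<sigma> (x t)) *v x t) = v (x t)"
      by (simp add: min_lyapunov_def)
    show "v (x s) \<le> x s \<bullet> (P (\<sigma> (x t)) *v x s)" for s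
      by (intro min_lyapunov_le min_switching_is_arg_min(1) N)
    \<comment> \<open>The selection inequality, the last conjunct of \<open>?Q t\<close>, passes
      from the fixed mode to the sum over the active modes.\<close>
    show "vdot P (\<sigma> (x t)) (x t) (?d t) \<le> - c * (norm (x t))\<^sup>2 - z t \<bullet> z t"
      using Q convexified_dissipation[of "x t" "\<lambda>i. \<alpha> i (x t)"]
      by (simp add: modified_output_def)
  qed
  with Z(1) that show thesis by blast
qed

text \<open>On a compact time interval the solution stays in a ball, where \<open>v\<close> is
  Lipschitz.\<close>

lemma abs_continuous_min_lyapunov_plus:
  assumes "0 \<le> T" "0 \<le> L"
    and g: "\<And>s t. \<lbrakk>0 \<le> s; s \<le> t; t \<le> T\<rbrakk> \<Longrightarrow> \<bar>g t - g s\<bar> \<le> L * (t - s)"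
  shows "abs_continuous_on_interval 0 T (\<lambda>t. v (x t) + g t)"
proof -
  have "compact (x ` {0..T})"
    by (intro compact_continuous_image solution_continuous_on) auto
  then have "bounded (x ` {0..T})" by (rule compact_imp_bounded)
  then obtain R where R: "\<And>t. t \<in> {0..T} \<Longrightarrow> norm (x t) \<le> R"
    unfolding bounded_iff by blast
  have "0 \<le> R" using R[of 0] assms(1) by (force intro: order_trans[OF norm_ge_zero])
  obtain K where K: "0 < K" "\<And>i x y. i \<in> {1..N} \<Longrightarrow> \<bar>x \<bullet> (P i *v y)\<bar> \<le> K * norm x * norm y"
    using bilinear_forms_upper_bound[of "{1..N}" P] by auto
  show ?thesis
  proof (rule abs_continuous_on_interval_dominated[of 0 T x "2 * K * R" L])
    show "abs_continuous_on_interval 0 T x"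
      using sol assms(1) by (auto simp: closed_loop_solution_def abs_continuous_halfline_def)
    show "norm (v (x t) + g t - (v (x s) + g s)) \<le> 2 * K * R * norm (x t - x s) + L * (t - s)"
      if "0 \<le> s" "s \<le> t" "t \<le> T" for s t
    proof -
      have "\<bar>v (x t) - v (x s)\<bar> \<le> 2 * K * R * norm (x t - x s)"
        using that K R by (intro min_lyapunov_Lipschitz N) auto
      with g[OF that] show ?thesis by simp
    qed
  qed (use K \<open>0 \<le> R\<close> assms(2) in auto)
qed

lemma energy_integral_Lipschitz:
  obtains M where "0 \<le> M" "\<And>s t. \<lbrakk>0 \<le> s; s \<le> t; t \<le> T\<rbrakk> \<Longrightarrow>
    \<bar>integral {0..t} (\<lambda>r. (norm (x r))\<^sup>2) - integral {0..s} (\<lambda>r. (norm (x r))\<^sup>2)\<bar> \<le> M * (t - s)"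
proof -
  let ?e = "\<lambda>r. (norm (x r))\<^sup>2"
  have cont: "continuous_on {a..t} ?e" if "0 \<le> a" for a t
    by (intro continuous_intros continuous_on_subset[OF solution_continuous_on[of t]]) (use that in auto)
  have "compact (?e ` {0..T})"
    using cont[of 0] by (intro compact_continuous_image) auto
  then obtain M where M: "\<And>t. t \<in> {0..T} \<Longrightarrow> \<bar>?e t\<bar> \<le> M"
    using compact_imp_bounded by (fastforce simp: bounded_iff)
  show thesis
  proof
    \<comment> \<open>For negative \<open>T\<close> the bound by \<open>M\<close> is vacuous and
      \<open>M\<close> may be negative.\<close>
    show "0 \<le> max 0 M" by simp
    fix s t assume st: "0 \<le> s" "s \<le> t" "t \<le> T"
    have int: "?e integrable_on {a..t}" if "0 \<le> a" for a t
      using that by (intro integrable_continuous_real cont)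
    have "integral {0..t} ?e - integral {0..s} ?e = integral {s..t} ?e"
      using Henstock_Kurzweil_Integration.integral_combine[OF st(1,2) int] by simp
    moreover have "norm (integral {s..t} ?e) \<le> max 0 M * (t - s)"
      using st M by (intro integral_bound cont) (auto simp: le_max_iff_disj)
    ultimately show "\<bar>integral {0..t} ?e - integral {0..s} ?e\<bar> \<le> max 0 M * (t - s)"
      by simp
  qed
qed

text \<open>Off a null set the right growth rates cancel: \<open>v\<close> contributes at most
  \<open>- c * (norm (x t))\<^sup>2 - z t \<bullet> z t\<close>, the energy term adds back the first
  part and the steps, lying below \<open>z t \<bullet> z t\<close>, at most the second.\<close>

lemma energy_estimate:
  assumes "0 \<le> S" "S \<le> T" "finite J" and K: "\<And>y. y \<in> J \<Longrightarrow> compact (K y) \<and> 0 \<le> y"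
    and disj: "disjoint_family_on K J"
    and le: "\<And>y t. y \<in> J \<Longrightarrow> t \<in> K y \<Longrightarrow> y \<le> z t \<bullet> z t"
  shows "v (x T) + c * integral {0..T} (\<lambda>r. (norm (x r))\<^sup>2) + step_integral J K T \<le>
    v (x S) + c * integral {0..S} (\<lambda>r. (norm (x r))\<^sup>2) + step_integral J K S"
proof -
  let ?e = "\<lambda>r. (norm (x r))\<^sup>2"
  define g where "g t = c * integral {0..t} ?e + step_integral J K t" for t
  obtain Z where Z: "Z \<in> null_sets lebesgue"
    "\<And>t. 0 \<le> t \<Longrightarrow> t \<notin> Z \<Longrightarrow> \<exists>W D. (W has_vector_derivative D) (at t within {0..}) \<and>
       W t = v (x t) \<and> (\<forall>s. v (x s) \<le> W s) \<and> D \<le> - c * (norm (x t))\<^sup>2 - z t \<bullet> z t"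
    using min_lyapunov_right_upper_derivative by blast
  obtain M where M: "0 \<le> M" "\<And>s t. \<lbrakk>0 \<le> s; s \<le> t; t \<le> T\<rbrakk> \<Longrightarrow>
    \<bar>integral {0..t} ?e - integral {0..s} ?e\<bar> \<le> M * (t - s)"
    using energy_integral_Lipschitz by blast
  have "abs_continuous_on_interval 0 T (\<lambda>t. v (x t) + g t)"
  proof (rule abs_continuous_min_lyapunov_plus)
    show "0 \<le> T" using assms(1,2) by simp
    show "0 \<le> c * M + (\<Sum>y\<in>J. y)"
      using c_pos M(1) K by (simp add: sum_nonneg)
    fix s t assume st: "0 \<le> s" "s \<le> t" "t \<le> T"
    have "\<bar>c * (integral {0..t} ?e - integral {0..s} ?e)\<bar> \<le> c * (M * (t - s))"
      using M(2)[OF st] c_pos by (simp add: abs_mult)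
    moreover have "\<bar>step_integral J K t - step_integral J K s\<bar> \<le> (\<Sum>y\<in>J. y) * (t - s)"
      using K st by (intro step_integral_Lipschitz) auto
    ultimately show "\<bar>g t - g s\<bar> \<le> (c * M + (\<Sum>y\<in>J. y)) * (t - s)"
      by (simp add: g_def right_diff_distrib distrib_right abs_le_iff)
  qed
  then have "abs_continuous_on_interval S T (\<lambda>t. v (x t) + g t)"
    using assms(1) by (rule abs_continuous_on_interval_subset) simp
  then have "v (x T) + g T \<le> v (x S) + g S"
    using \<open>S \<le> T\<close> Z(1)
  proof (rule abs_continuous_right_derivative_nonpos_imp_le)
    fix t \<epsilon> :: real assume "S \<le> t" "t < T" "t \<notin> Z" and "\<epsilon> > 0"
    with \<open>0 \<le> S\<close> have t: "0 \<le> t" "t < T" "t \<notin> Z" by auto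
    obtain W D where W: "(W has_vector_derivative D) (at t within {0..})" "W t = v (x t)"
      "\<And>s. v (x s) \<le> W s" "D \<le> - c * (norm (x t))\<^sup>2 - z t \<bullet> z t"
      using Z(2) t by blast
    have "((\<lambda>s. integral {0..s} ?e) has_vector_derivative ?e t) (at t within {0..T})"
      using t by (intro integral_has_vector_derivative continuous_intros solution_continuous_on) auto
    \<comment> \<open>Restricting to \<open>{t..T}\<close> turns the derivatives into right
      derivatives.\<close>
    then have "((\<lambda>s. integral {0..s} ?e) has_real_derivative ?e t) (at t within {t..T})"
      unfolding has_real_derivative_iff_has_vector_derivative
      by (rule has_vector_derivative_within_subset) (use t in auto)
    moreover have "(W has_real_derivative D) (at t within {t..T})"
      unfolding has_real_derivative_iff_has_vector_derivative
      using W(1) by (rule has_vector_derivative_within_subset) (use t in auto)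
    ultimately have "((\<lambda>s. W s + c * integral {0..s} ?e) has_real_derivative D + c * ?e t) (at t within {t..T})"
      by (intro DERIV_add DERIV_cmult)
    moreover have "at t within {t..T} = at_right t"
      using t by (simp add: at_within_Icc_at_right)
    ultimately have "((\<lambda>s. (W s + c * integral {0..s} ?e - (W t + c * integral {0..t} ?e)) / (s - t))
        \<longlongrightarrow> D + c * ?e t) (at_right t)"
      by (simp add: has_field_derivative_iff)
    then have "\<forall>\<^sub>F s in at_right t. (W s + c * integral {0..s} ?e - (W t + c * integral {0..t} ?e)) / (s - t)
        < D + c * ?e t + \<epsilon>"
      using \<open>\<epsilon> > 0\<close> by (intro order_tendstoD) auto
    moreover have "\<forall>\<^sub>F s in at_right t. step_integral J K s - step_integral J K t \<le> (z t \<bullet> z t) * (s - t)"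
      using \<open>finite J\<close> K disj t(1) le by (intro step_integral_right_increment_le) auto
    moreover have "\<forall>\<^sub>F s in at_right t. t < s"
      by (simp add: eventually_at_filter)
    ultimately show "\<forall>\<^sub>F s in at_right t. v (x s) + g s - (v (x t) + g t) \<le> \<epsilon> * (s - t)"
    proof eventually_elim
      case (elim s)
      have "W s + c * integral {0..s} ?e - (W t + c * integral {0..t} ?e) \<le> (D + c * ?e t + \<epsilon>) * (s - t)"
        using elim(1,3) by (simp add: pos_divide_less_eq less_imp_le)
      \<comment> \<open>\<open>W\<close> agrees with \<open>v\<close> at time \<open>t\<close> and
        dominates it at \<open>s\<close>, so the increment of \<open>v\<close> is at most that of
        \<open>W\<close>.\<close>
      then have "v (x s) + g s - (v (x t) + g t) \<le> (D + c * ?e t + z t \<bullet> z t + \<epsilon>) * (s - t)"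
        using elim(2) W(2) W(3)[of s] by (simp add: g_def distrib_right)
      also have "\<dots> \<le> \<epsilon> * (s - t)"
        using elim(3) W(4) by (intro mult_right_mono) auto
      finally show ?case .
    qed
  qed
  then show ?thesis by (simp add: g_def)
qed

section \<open>Consequences of the energy estimate: monotonicity, decay, output energy\<close>

lemma energy_integrable: "(\<lambda>r. (norm (x r))\<^sup>2) integrable_on {0..T}"
  by (intro integrable_continuous_real continuous_intros solution_continuous_on)

lemma energy_integral_mono:
  assumes "0 \<le> S" "S \<le> T"
  shows "integral {0..S} (\<lambda>r. (norm (x r))\<^sup>2) \<le> integral {0..T} (\<lambda>r. (norm (x r))\<^sup>2)"
  using assms by (intro integral_subset_le energy_integrable) auto

lemma min_lyapunov_energy:
  assumes "0 \<le> S" "S \<le> T"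
  shows "v (x T) + c * integral {0..T} (\<lambda>r. (norm (x r))\<^sup>2) \<le>
    v (x S) + c * integral {0..S} (\<lambda>r. (norm (x r))\<^sup>2)"
  using energy_estimate[OF assms, of "{}" "\<lambda>_. {}"]
  by (simp add: step_integral_def disjoint_family_on_def)

lemma min_lyapunov_antimono:
  assumes "0 \<le> S" "S \<le> T"
  shows "v (x T) \<le> v (x S)"
proof -
  have "c * integral {0..S} (\<lambda>r. (norm (x r))\<^sup>2) \<le> c * integral {0..T} (\<lambda>r. (norm (x r))\<^sup>2)"
    using c_pos assms by (intro mult_left_mono energy_integral_mono) auto
  with min_lyapunov_energy[OF assms] show ?thesis by linarith
qed

text \<open>Since \<open>v\<close> is nonincreasing along the solution, the dissipated energy up to time \<open>T\<close> is at least
  proportional to \<open>T * v (x T)\<close>.\<close>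

lemma min_lyapunov_decay:
  assumes "0 \<le> T" "0 < b" "\<And>y. v y \<le> b * (norm y)\<^sup>2"
  shows "v (x T) \<le> v (x 0) / (1 + c / b * T)"
proof -
  have "T * (v (x T) / b) = integral {0..T} (\<lambda>_. v (x T) / b)"
    using assms(1) by simp
  also have "\<dots> \<le> integral {0..T} (\<lambda>r. (norm (x r))\<^sup>2)"
  proof (rule integral_le)
    show "v (x T) / b \<le> (norm (x r))\<^sup>2" if "r \<in> {0..T}" for r
      using min_lyapunov_antimono[of r T] assms(3)[of "x r"] that assms(2)
      by (simp add: pos_divide_le_eq mult.commute)
  qed (auto intro: energy_integrable)
  finally have "c * (T * (v (x T) / b)) \<le> c * integral {0..T} (\<lambda>r. (norm (x r))\<^sup>2)"
    using c_pos by (intro mult_left_mono) auto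
  then have "v (x T) * (1 + c / b * T) \<le> v (x 0)"
    using min_lyapunov_energy[of 0 T] assms(1) by (simp add: algebra_simps)
  moreover have "0 < 1 + c / b * T"
    using assms(1,2) c_pos by (simp add: add_pos_nonneg)
  ultimately show ?thesis by (simp add: pos_le_divide_eq)
qed

text \<open>The energy estimate bounds every step function below the squared output. The state
  energy up to time 1 is kept on the right as a margin that later yields strictness.\<close>

lemma sq_L2_norm_output_le:
  "sq_L2_norm z \<le> ennreal (v (x 0) - c * integral {0..1} (\<lambda>r. (norm (x r))\<^sup>2))"
  unfolding sq_L2_norm_def
proof (rule nn_integral_le_compact_steps)
  fix J and K :: "real \<Rightarrow> real set"
  assume J: "finite J" and K: "\<And>y. y \<in> J \<Longrightarrow> compact (K y) \<and> 0 \<le> y" and disj: "disjoint_family_on K J"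
    and le: "\<And>y t. y \<in> J \<Longrightarrow> t \<in> K y \<Longrightarrow> 0 \<le> t \<and> y \<le> z t \<bullet> z t"
  have "bounded (\<Union>y\<in>J. K y)"
    using J K by (intro bounded_UN) (auto intro: compact_imp_bounded)
  then obtain R where R: "\<And>t. t \<in> (\<Union>y\<in>J. K y) \<Longrightarrow> \<bar>t\<bar> \<le> R"
    unfolding bounded_iff real_norm_def by blast
  \<comment> \<open>All steps lie in \<open>{0..T}\<close>, and \<open>1 \<le> T\<close> retains the
    energy up to time 1.\<close>
  define T where "T = max 1 R"
  have "K y \<inter> {0..T} = K y" if "y \<in> J" for y
  proof -
    have "t \<le> T" "0 \<le> t" if "t \<in> K y" for t
      using R[of t] le[of y t] that \<open>y \<in> J\<close> by (force simp: T_def)+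
    then show ?thesis by auto
  qed
  then have "(\<Sum>y\<in>J. y * measure lebesgue (K y)) = step_integral J K T"
    by (simp add: step_integral_def)
  moreover have "v (x T) + c * integral {0..T} (\<lambda>r. (norm (x r))\<^sup>2) + step_integral J K T \<le>
      v (x 0) + c * integral {0..0} (\<lambda>r. (norm (x r))\<^sup>2) + step_integral J K 0"
    using J K disj le by (intro energy_estimate) (auto simp: T_def)
  moreover have "c * integral {0..1} (\<lambda>r. (norm (x r))\<^sup>2) \<le> c * integral {0..T} (\<lambda>r. (norm (x r))\<^sup>2)"
    using c_pos by (intro mult_left_mono energy_integral_mono) (auto simp: T_def)
  moreover have "step_integral J K 0 = 0"
  proof -
    have "negligible (K y \<inter> {0..0})" for y
      by (rule negligible_subset[OF negligible_sing[of 0]]) auto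
    then have "measure lebesgue (K y \<inter> {0..0}) = 0" for y
      by (rule negligible_imp_measure0)
    then show ?thesis by (simp add: step_integral_def)
  qed
  ultimately show "(\<Sum>y\<in>J. y * measure lebesgue (K y)) \<le> v (x 0) - c * integral {0..1} (\<lambda>r. (norm (x r))\<^sup>2)"
    using min_lyapunov_nonneg[of "x T"] by simp
qed simp

text \<open>A continuous nonnegative function with zero integral vanishes identically, but here the
  integrand is positive at time 0.\<close>

lemma energy_integral_pos:
  assumes "x 0 \<noteq> 0"
  shows "0 < integral {0..1} (\<lambda>r. (norm (x r))\<^sup>2)"
proof -
  have "continuous_on {0..1} (\<lambda>r. (norm (x r))\<^sup>2)"
    by (intro continuous_intros solution_continuous_on)
  then have "integral {0..1} (\<lambda>r. (norm (x r))\<^sup>2) \<noteq> 0"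
    using assms by (subst integral_eq_0_iff) auto
  moreover have "0 \<le> integral {0..1} (\<lambda>r. (norm (x r))\<^sup>2)"
    by (intro integral_nonneg energy_integrable) auto
  ultimately show ?thesis by simp
qed

end

section \<open>Global asymptotic stability and the bound on the index\<close>

lemma min_lyapunov_bounds:
  obtains a b where "0 < a" "0 < b" "\<And>x. a * (norm x)\<^sup>2 \<le> v x" "\<And>x. v x \<le> b * (norm x)\<^sup>2"
proof -
  obtain a where a: "0 < a" "\<And>i x. i \<in> {1..N} \<Longrightarrow> a * (norm x)\<^sup>2 \<le> x \<bullet> (P i *v x)"
    using quadratic_forms_lower_bound[of "{1..N}" P] P_pos unfolding pos_definite_def by blast
  obtain b where b: "0 < b" "\<And>i x y. i \<in> {1..N} \<Longrightarrow> \<bar>x \<bullet> (P i *v y)\<bar> \<le> b * norm x * norm y"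
    using bilinear_forms_upper_bound[of "{1..N}" P] by auto
  show thesis
  proof
    fix x
    have i: "\<sigma> x \<in> {1..N}" using N by (rule min_switching_is_arg_min)
    show "a * (norm x)\<^sup>2 \<le> v x"
      using a(2)[OF i] by (simp add: min_lyapunov_def)
    show "v x \<le> b * (norm x)\<^sup>2"
      using b(2)[OF i, of x x] by (simp add: min_lyapunov_def power2_eq_square mult.assoc)
  qed (use a b in auto)
qed

text \<open>With \<open>v\<close> between two multiples of the squared norm, monotonicity of
  \<open>v\<close> along solutions gives stability and its decay of order 1/t gives
  attractivity.\<close>

theorem origin_stable:
  fixes E :: "real^'q^'n"
  shows "origin_globally_asymptotically_stable N A (\<lambda>i. E) P \<sigma>"
proof -
  obtain a b where ab: "0 < a" "0 < b" "\<And>x. a * (norm x)\<^sup>2 \<le> v x" "\<And>x. v x \<le> b * (norm x)\<^sup>2"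
    using min_lyapunov_bounds by blast
  show ?thesis
    unfolding origin_globally_asymptotically_stable_def
  proof (intro conjI allI impI)
    fix \<epsilon> :: real assume "\<epsilon> > 0"
    show "\<exists>\<delta>>0. \<forall>x \<alpha>. closed_loop_solution N A (\<lambda>i. E) P \<sigma> (\<lambda>t. 0) x \<alpha> \<longrightarrow> norm (x 0) < \<delta> \<longrightarrow>
        (\<forall>t\<ge>0. norm (x t) < \<epsilon>)"
    \<comment> \<open>The radius is read off from
      \<open>a * (norm (x t))\<^sup>2 \<le> b * (norm (x 0))\<^sup>2\<close>.\<close>
    proof (intro exI[of _ "sqrt (a / b) * \<epsilon>"] conjI allI impI)
      show "0 < sqrt (a / b) * \<epsilon>" using ab \<open>\<epsilon> > 0\<close> by simp
      fix x \<alpha> and t :: real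
      assume sol: "closed_loop_solution N A (\<lambda>i. E) P \<sigma> (\<lambda>t. 0) x \<alpha>"
        and x0: "norm (x 0) < sqrt (a / b) * \<epsilon>" and "0 \<le> t"
      have "a * (norm (x t))\<^sup>2 \<le> b * (norm (x 0))\<^sup>2"
        using min_lyapunov_antimono[OF sol, of 0 t] ab(3)[of "x t"] ab(4)[of "x 0"] \<open>0 \<le> t\<close> by simp
      also have "\<dots> < b * (sqrt (a / b) * \<epsilon>)\<^sup>2"
        using x0 ab by (intro mult_strict_left_mono power_strict_mono) auto
      also have "\<dots> = a * \<epsilon>\<^sup>2"
        using ab by (simp add: power_mult_distrib)
      finally show "norm (x t) < \<epsilon>"
        using ab \<open>\<epsilon> > 0\<close> by (simp add: power_less_imp_less_base)
    qed
  next
    fix x \<alpha> assume sol: "closed_loop_solution N A (\<lambda>i. E) P \<sigma> (\<lambda>t. 0) x \<alpha>"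
    have bound: "(norm (x t))\<^sup>2 \<le> (v (x 0) / a) / (1 + c / b * t)" if "0 \<le> t" for t
    proof -
      have "a * (norm (x t))\<^sup>2 \<le> v (x 0) / (1 + c / b * t)"
        using min_lyapunov_decay[OF sol that ab(2) ab(4)] ab(3)[of "x t"] by linarith
      then have "(norm (x t))\<^sup>2 \<le> v (x 0) / (1 + c / b * t) / a"
        using ab(1) by (simp only: pos_le_divide_eq mult.commute)
      then show ?thesis by (simp only: divide_divide_eq_left mult.commute)
    qed
    have "filterlim (\<lambda>t. 1 + c / b * t) at_top at_top"
      using c_pos ab(2)
      by (intro filterlim_tendsto_add_at_top[OF tendsto_const]
          filterlim_tendsto_pos_mult_at_top[OF tendsto_const] filterlim_ident) auto
    then have "((\<lambda>t. (v (x 0) / a) / (1 + c / b * t)) \<longlongrightarrow> 0) at_top"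
      by (intro tendsto_divide_0[OF tendsto_const] filterlim_at_top_imp_at_infinity)
    then have "((\<lambda>t. (norm (x t))\<^sup>2) \<longlongrightarrow> 0) at_top"
    proof (rule tendsto_sandwich[OF _ _ tendsto_const, rotated -1])
      show "\<forall>\<^sub>F t in at_top. (norm (x t))\<^sup>2 \<le> (v (x 0) / a) / (1 + c / b * t)"
        using eventually_ge_at_top[of 0] bound by (rule eventually_mono)
    qed simp
    then show "(x \<longlongrightarrow> 0) at_top"
      using tendsto_real_sqrt[of "\<lambda>t. (norm (x t))\<^sup>2"] by (simp add: tendsto_norm_zero_iff)
  qed
qed

text \<open>Response \<open>k\<close> contributes at most \<open>v (x k 0)\<close> minus the margin
  \<open>e k\<close>. Some column of \<open>E\<close> is nonzero, so one margin is positive;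
  bounding \<open>v\<close> by the form of mode \<open>i\<close> and summing over \<open>k\<close>
  gives the trace.\<close>

theorem J2_less:
  fixes E :: "real^'q^'n" and F :: "nat \<Rightarrow> real^'q^'p"
  assumes "E \<noteq> 0" and resp: "impulse_responses N A E P \<sigma> x \<alpha>" and "i \<in> {1..N}"
  shows "J2 N C F \<sigma> x \<alpha> < ennreal (trace (transpose E ** P i ** E))"
proof -
  have sol: "closed_loop_solution N A (\<lambda>i. E) P \<sigma> (\<lambda>t. 0) (x k) (\<alpha> k)"
    and init: "x k 0 = E *v axis k 1" for k
    using resp by (auto simp: impulse_responses_def)
  define e where "e k = c * integral {0..1} (\<lambda>r. (norm (x k r))\<^sup>2)" for k
  have e_nonneg: "0 \<le> e k" for k
    unfolding e_def using c_pos energy_integrable[OF sol]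
    by (intro mult_nonneg_nonneg integral_nonneg) auto
  \<comment> \<open>Keeps the differences \<open>v (x k 0) - e k\<close> nonnegative, so that
    \<open>ennreal\<close> does not truncate them when summed.\<close>
  have e_le: "e k \<le> v (x k 0)" for k
    using min_lyapunov_energy[OF sol, of 0 1 k] min_lyapunov_nonneg[of "x k 1"] by (simp add: e_def)
  obtain k where k: "E *v axis k 1 \<noteq> 0"
  proof (rule ccontr)
    assume "\<not> thesis"
    then have "column k E = 0" for k using that by (metis matrix_vector_mult_basis)
    then have "E = 0" by (simp add: column_def vec_eq_iff)
    with \<open>E \<noteq> 0\<close> show False ..
  qed
  then have "0 < e k"
    using energy_integral_pos[OF sol] c_pos by (simp add: e_def init)
  have "J2 N C F \<sigma> x \<alpha> \<le> (\<Sum>k\<in>UNIV. ennreal (v (x k 0) - e k))"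
    unfolding J2_def e_def by (intro sum_mono sq_L2_norm_output_le[OF sol])
  also have "\<dots> = ennreal (\<Sum>k\<in>UNIV. v (x k 0) - e k)"
    using e_le by (intro sum_ennreal) simp
  also have "\<dots> < ennreal (\<Sum>k\<in>UNIV. v (x k 0))"
  proof (subst ennreal_less_iff)
    show "0 \<le> (\<Sum>k\<in>UNIV. v (x k 0) - e k)"
      using e_le by (intro sum_nonneg) simp
    show "(\<Sum>k\<in>UNIV. v (x k 0) - e k) < (\<Sum>k\<in>UNIV. v (x k 0))"
      using e_nonneg \<open>0 < e k\<close> by (intro sum_strict_mono_ex1) auto
  qed
  also have "\<dots> \<le> ennreal (trace (transpose E ** P i ** E))"
    unfolding trace_transpose_mult init
    using N assms(3) by (intro ennreal_leI sum_mono min_lyapunov_le)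
  finally show ?thesis .
qed

end

text \<open>For \<open>E = 0\<close> every trace vanishes and no value in \<open>ennreal\<close>
  lies strictly below 0; this is why the strict bound is stated for \<open>E \<noteq> 0\<close>. It
  is claimed for every choice of responses, since solutions need not be unique.\<close>

theorem propositionA2:
  fixes N :: nat
    and A :: "nat \<Rightarrow> real^'n^'n"
    and C :: "nat \<Rightarrow> real^'n^'p"
    and E :: "real^'q^'n"
    and F :: "nat \<Rightarrow> real^'q^'p"
    and P :: "nat \<Rightarrow> real^'n^'n"
    and \<pi> :: "nat \<Rightarrow> nat \<Rightarrow> real"
  assumes "N \<ge> 1"
    and "\<forall>i\<in>{1..N}. pos_definite (P i)"
    and "\<pi> \<in> metzler_zero_colsum N"
    and "\<forall>i\<in>{1..N}. neg_definite
           (transpose (A i) ** P i + P i ** A i + (\<Sum>j=1..N. \<pi> j i *\<^sub>R P j) + transpose (C i) ** C i)"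
  shows "origin_globally_asymptotically_stable N A (\<lambda>i. E) P (min_switching N P) \<and>
    ((\<forall>i\<in>{1..N}. F i = 0) \<longrightarrow> E \<noteq> 0 \<longrightarrow>
      (\<forall>x \<alpha>. impulse_responses N A E P (min_switching N P) x \<alpha> \<longrightarrow>
        J2 N C F (min_switching N P) x \<alpha>
          < ennreal (Min ((\<lambda>i. trace (transpose E ** P i ** E)) ` {1..N}))))"
proof -
  define Q where "Q i = transpose (A i) ** P i + P i ** A i + (\<Sum>j=1..N. \<pi> j i *\<^sub>R P j) + transpose (C i) ** C i"
    for i
  have neg: "x \<bullet> (- Q i *v x) = - (x \<bullet> (Q i *v x))" for i x
  proof -
    have "- Q i *v x = - (Q i *v x)"
      using scaleR_matrix_vector_assoc[of "-1" "Q i" x] by simp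
    then show ?thesis by simp
  qed
  have "0 < x \<bullet> (- Q i *v x)" if "i \<in> {1..N}" "x \<noteq> 0" for i x
    using assms(4) that unfolding neg by (simp add: neg_definite_def Q_def)
  \<comment> \<open>Strict definiteness for each of finitely many modes gives one common
    margin.\<close>
  then obtain c where "0 < c" and c: "\<And>i x. i \<in> {1..N} \<Longrightarrow> c * (norm x)\<^sup>2 \<le> x \<bullet> (- Q i *v x)"
    using quadratic_forms_lower_bound[of "{1..N}" "\<lambda>i. - Q i"] by blast
  interpret lyapunov_metzler N A C P \<pi> c
  proof
    show "x \<bullet> ((transpose (A i) ** P i + P i ** A i + (\<Sum>j=1..N. \<pi> j i *\<^sub>R P j) + transpose (C i) ** C i) *v x)
        \<le> - c * (norm x)\<^sup>2" if "i \<in> {1..N}" for i x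
      using c[OF that, of x] unfolding neg by (simp add: Q_def)
  qed (use assms \<open>0 < c\<close> in auto)
  \<comment> \<open>The minimum is attained at some mode, so the bound for a single mode
    suffices.\<close>
  have "Min ((\<lambda>i. trace (transpose E ** P i ** E)) ` {1..N}) \<in> (\<lambda>i. trace (transpose E ** P i ** E)) ` {1..N}"
    using assms(1) by (intro Min_in) auto
  then obtain i where i: "i \<in> {1..N}"
    and Min_eq: "Min ((\<lambda>i. trace (transpose E ** P i ** E)) ` {1..N}) = trace (transpose E ** P i ** E)"
    by (elim imageE)
  show ?thesis
    unfolding Min_eq using origin_stable[of E] J2_less[OF _ _ i, of E] by (intro conjI allI impI)
qed

end
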